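(* Let $(\mathbb{C},p:\dot{\mathcal{U}}\to\mathcal{U})$ be a natural model and let $O\in\mathcal{U}(\diamond)$. Let $(\mathbb{C}_{x:O},p_{x:O})$ be the free natural model on $(\mathbb{C},p)$ extended by a term $x$ of type $O$, with its distinguished term $x\in\dot{\mathcal{U}}_{x:O}(\diamond_{x:O};O)$ and inclusion morphism $I:(\mathbb{C},p)\to(\mathbb{C}_{x:O},p_{x:O})$, as constructed explicitly in the context. Given any natural model $(\mathbb{D},q:\dot{\mathcal{V}}\to\mathcal{V})$ with distinguished terminal object $\star$, any morphism of natural models $F:(\mathbb{C},p)\to(\mathbb{D},q)$ and any element $o\in\dot{\mathcal{V}}(\star;FO)$, there is a unique morphism of natural models $F^\sharp:(\mathbb{C}_{x:O},p_{x:O})\to(\mathbb{D},q)$ such that $F^\sharp\circ I=F$ and $F^\sharp(x)=o\in\dot{\mathcal{V}}(\star;FO)$.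
   Context: $\mathsf{y}$ is the Yoneda embedding; elements $x\in P(\Gamma)$ of a presheaf are identified with maps $\mathsf{y}(\Gamma)\to P$, and $x[\sigma]=P(\sigma)(x)$. A natural model $(\mathbb{C},p)$ consists of a small category $\mathbb{C}$ with a distinguished terminal object $\diamond$, presheaves $\mathcal{U},\dot{\mathcal{U}}$ on $\mathbb{C}$, a natural transformation $p:\dot{\mathcal{U}}\to\mathcal{U}$ and, for each object $\Gamma$ and $A\in\mathcal{U}(\Gamma)$, a chosen object $\Gamma\cdot A$, morphism $\mathsf{p}_A:\Gamma\cdot A\to\Gamma$ and element $\mathsf{q}_A\in\dot{\mathcal{U}}(\Gamma\cdot A)$ such that the square with top $\mathsf{q}_A$, right $p$, left $\mathsf{y}(\mathsf{p}_A)$, bottom $A$ is a pullback. Write $\dot{\mathcal{U}}(\Gamma;A)=p_\Gamma^{-1}(A)$ and $\mathsf{t}_\Gamma:\Gamma\to\diamond$ for the unique map. For $\sigma:\Delta\to\Gamma$ and $A\in\mathcal{U}(\Gamma)$, $\sigma\cdot A:\Delta\cdot A[\sigma]\to\Gamma\cdot A$ is the unique map with $\mathsf{p}_A\circ(\sigma\cdot A)=\sigma\circ\mathsf{p}_{A[\sigma]}$ and $\mathsf{q}_A[\sigma\cdot A]=\mathsf{q}_{A[\sigma]}$; the resulting square is a pullback, called canonical. A morphism of natural models $F:(\mathbb{C},p)\to(\mathbb{D},q:\dot{\mathcal{V}}\to\mathcal{V})$ is a functor $F:\mathbb{C}\to\mathbb{D}$ strictly preserving distinguished terminal objects together with functions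 $A\mapsto FA:\mathcal{U}(\Gamma)\to\mathcal{V}(F\Gamma)$ and $a\mapsto Fa:\dot{\mathcal{U}}(\Gamma)\to\dot{\mathcal{V}}(F\Gamma)$, natural in $\Gamma$, with $q(Fa)=F(p(a))$ and strictly preserving the chosen data: $F(\Gamma\cdot A)=F\Gamma\cdot FA$, $F(\mathsf{p}_A)=\mathsf{p}_{FA}$, $F(\mathsf{q}_A)=\mathsf{q}_{FA}$. Composition is the evident one. **Swap isomorphisms.** Write $O$ also for the elements $O[\mathsf{t}_\Gamma]\in\mathcal{U}(\Gamma)$. For $A\in\mathcal{U}(\Gamma)$, the swap isomorphism $\mathsf{sw}:\Gamma\cdot O\cdot A[\mathsf{p}_O]\to\Gamma\cdot A\cdot O$ is the isomorphism determined by $\mathsf{p}_O\circ\mathsf{sw}=\mathsf{p}_O\cdot A$ and $(\mathsf{p}_A\cdot O)\circ\mathsf{sw}=\mathsf{p}_{A[\mathsf{p}_O]}$, using the canonical pullback squares. It induces isomorphisms, also called swap isomorphisms, $\Gamma\cdot O\cdot A\cdot A_1\cdots A_n\cong\Gamma\cdot A\cdot O\cdot A_1\cdots A_n$ (substitutions suppressed). **The category $\mathbb{C}_{x:O}$.** Objects are $(n+1)$-tuples $(\Gamma;A_1,\dots,A_n)$, $n\ge0$, with $\Gamma$ an object of $\mathbb{C}$ and $A_{i+1}\in\mathcal{U}(\Gamma\cdot O\cdot A_1\cdots A_i)$ for each $i<n$, where $(\Gamma\cdot A;A_1,\dots,A_n)$ is identified with $(\Gamma;A[\mathsf{p}_O],A_1,\dots,A_n)$,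 the swap isomorphisms being suppressed. Each object has a unique expression with $n$ minimal, called its normal form; unless otherwise specified, expressions of objects as lists are assumed to be in normal form. A morphism $(\Delta;B_1,\dots,B_m)\to(\Gamma;A_1,\dots,A_n)$ is a morphism $\Delta\cdot O\cdot B_1\cdots B_m\to\Gamma\cdot O\cdot A_1\cdots A_n$ in $\mathbb{C}$ commuting with the canonical morphisms to $\diamond\cdot O$, which are the iterated projection to $\Delta\cdot O$ followed by $\mathsf{t}_\Delta\cdot O$, respectively the iterated projection to $\Gamma\cdot O$ followed by $\mathsf{t}_\Gamma\cdot O$. Identities and composition are inherited from the slice of $\mathbb{C}$ over $\diamond\cdot O$. **The natural model $(\mathbb{C}_{x:O},p_{x:O}:\dot{\mathcal{U}}_{x:O}\to\mathcal{U}_{x:O})$.** The distinguished terminal object is $\diamond_{x:O}=(\diamond)$. The presheaves and natural transformation are obtained from $p:\dot{\mathcal{U}}\to\mathcal{U}$ by precomposition with the functor $(\Gamma;A_1,\dots,A_n)\mapsto\Gamma\cdot O\cdot A_1\cdots A_n$: thus $\mathcal{U}_{x:O}(\Gamma;A_1,\dots,A_n)=\mathcal{U}(\Gamma\cdot O\cdot A_1\cdots A_n)$, likewise for $\dot{\mathcal{U}}_{x:O}$, and $(p_{x:O})_{(\Gamma;A_1,\dots,A_n)}=p_{\Gamma\cdot O\cdot A_1\cdots A_n}$. Representability data for $A\in\mathcal{U}_{x:O}(\Gamma;A_1,\dots,A_n)$: $(\Gamma;A_1,\dots,A_n)\cdot A=(\Gamma;A_1,\dots,A_n,A)$ (if $n=0$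 and $A=A'[\mathsf{p}_O]$ with $A'\in\mathcal{U}(\Gamma)$, its normal form is $(\Gamma\cdot A')$); the projection is the morphism $\mathsf{p}_A:\Gamma\cdot O\cdot A_1\cdots A_n\cdot A\to\Gamma\cdot O\cdot A_1\cdots A_n$ of $\mathbb{C}$ (or $\mathsf{p}_A\circ\mathsf{sw}^{-1}:\Gamma\cdot A'\cdot O\to\Gamma\cdot O$ in the special case); the chosen element is $\mathsf{q}_A\in\dot{\mathcal{U}}(\Gamma\cdot O\cdot A_1\cdots A_n\cdot A)$ (or $\mathsf{q}_A[\mathsf{sw}^{-1}]\in\dot{\mathcal{U}}(\Gamma\cdot A'\cdot O)$ in the special case). The distinguished term $x\in\dot{\mathcal{U}}_{x:O}(\diamond_{x:O};O)$ is the element $\mathsf{q}_O\in\dot{\mathcal{U}}(\diamond\cdot O)$. **The inclusion.** $I:(\mathbb{C},p)\to(\mathbb{C}_{x:O},p_{x:O})$ is the morphism of natural models with $I\Gamma=(\Gamma)$, $I\sigma=\sigma\cdot O$, $IA=A[\mathsf{p}_O]$ and $Ia=a[\mathsf{p}_O]$.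
   Formalization: If A ↦ A[p_O] is not injective (e.g. O empty), normal forms are not unique. The formal version keeps minimal lists as distinct objects, chooses A' with A = A'[p_O], and then does not claim that I is a strict morphism; for injective weakening it is the stated construction. *)

theory Defs
  imports Main "HOL-Library.FuncSet"
begin

section \<open>Small categories and presheaves\<close>

record ('o, 'm) category =
  Obj :: "'o set"
  Arr :: "'m set"
  Dom :: "'m \<Rightarrow> 'o"
  Cod :: "'m \<Rightarrow> 'o"
  Id :: "'o \<Rightarrow> 'm"
  Comp :: "'m \<Rightarrow> 'm \<Rightarrow> 'm"  \<comment> \<open>\<open>Comp C g f\<close> is \<open>g\<close> after \<open>f\<close>\<close>

definition Hom :: "('o, 'm) category \<Rightarrow> 'o \<Rightarrow> 'o \<Rightarrow> 'm set"
  where "Hom C X Y = {f \<in> Arr C. Dom C f = X \<and> Cod C f = Y}"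

locale small_category =
  fixes C :: "('o, 'm) category"
  assumes Dom_closed: "f \<in> Arr C \<Longrightarrow> Dom C f \<in> Obj C"
    and Cod_closed: "f \<in> Arr C \<Longrightarrow> Cod C f \<in> Obj C"
    and Id_Hom: "X \<in> Obj C \<Longrightarrow> Id C X \<in> Hom C X X"
    and Comp_Hom: "\<lbrakk>f \<in> Hom C X Y; g \<in> Hom C Y Z\<rbrakk> \<Longrightarrow> Comp C g f \<in> Hom C X Z"
    and Comp_Id_left: "f \<in> Hom C X Y \<Longrightarrow> Comp C (Id C Y) f = f"
    and Comp_Id_right: "f \<in> Hom C X Y \<Longrightarrow> Comp C f (Id C X) = f"
    and Comp_assoc: "\<lbrakk>f \<in> Hom C W X; g \<in> Hom C X Y; h \<in> Hom C Y Z\<rbrakk>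
      \<Longrightarrow> Comp C h (Comp C g f) = Comp C (Comp C h g) f"

definition is_functor ::
    "('o1, 'm1) category \<Rightarrow> ('o2, 'm2) category \<Rightarrow> ('o1 \<Rightarrow> 'o2) \<Rightarrow> ('m1 \<Rightarrow> 'm2) \<Rightarrow> bool"
  where "is_functor C D Fo Fa \<longleftrightarrow>
    Fo \<in> Obj C \<rightarrow> Obj D \<and>
    (\<forall>X\<in>Obj C. \<forall>Y\<in>Obj C. Fa \<in> Hom C X Y \<rightarrow> Hom D (Fo X) (Fo Y)) \<and>
    (\<forall>X\<in>Obj C. Fa (Id C X) = Id D (Fo X)) \<and>
    (\<forall>X\<in>Obj C. \<forall>Y\<in>Obj C. \<forall>Z\<in>Obj C. \<forall>f\<in>Hom C X Y. \<forall>g\<in>Hom C Y Z.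
      Fa (Comp C g f) = Comp D (Fa g) (Fa f))"

definition is_terminal :: "('o, 'm) category \<Rightarrow> 'o \<Rightarrow> bool"
  where "is_terminal C T \<longleftrightarrow> T \<in> Obj C \<and> (\<forall>X\<in>Obj C. \<exists>!f. f \<in> Hom C X T)"

definition inverse_arr :: "('o, 'm) category \<Rightarrow> 'm \<Rightarrow> 'm"
  where "inverse_arr C f = (THE g. g \<in> Hom C (Cod C f) (Dom C f) \<and>
    Comp C g f = Id C (Dom C f) \<and> Comp C f g = Id C (Cod C f))"

text \<open>\<open>Act P \<sigma> x\<close> is the restriction of \<open>x \<in> P (Cod \<sigma>)\<close> along \<open>\<sigma>\<close>.\<close>

record ('o, 'm, 'x) presheaf =
  Sec :: "'o \<Rightarrow> 'x set"
  Act :: "'m \<Rightarrow> 'x \<Rightarrow> 'x"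

definition is_presheaf :: "('o, 'm) category \<Rightarrow> ('o, 'm, 'x) presheaf \<Rightarrow> bool"
  where "is_presheaf C P \<longleftrightarrow>
    (\<forall>\<Delta>\<in>Obj C. \<forall>\<Gamma>\<in>Obj C. \<forall>\<sigma>\<in>Hom C \<Delta> \<Gamma>. Act P \<sigma> \<in> Sec P \<Gamma> \<rightarrow> Sec P \<Delta>) \<and>
    (\<forall>\<Gamma>\<in>Obj C. \<forall>x\<in>Sec P \<Gamma>. Act P (Id C \<Gamma>) x = x) \<and>
    (\<forall>\<Theta>\<in>Obj C. \<forall>\<Delta>\<in>Obj C. \<forall>\<Gamma>\<in>Obj C. \<forall>\<tau>\<in>Hom C \<Theta> \<Delta>. \<forall>\<sigma>\<in>Hom C \<Delta> \<Gamma>. \<forall>x\<in>Sec P \<Gamma>.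
      Act P (Comp C \<sigma> \<tau>) x = Act P \<tau> (Act P \<sigma> x))"

definition is_natural ::
    "('o, 'm) category \<Rightarrow> ('o, 'm, 'x) presheaf \<Rightarrow> ('o, 'm, 'y) presheaf \<Rightarrow> ('o \<Rightarrow> 'x \<Rightarrow> 'y) \<Rightarrow> bool"
  where "is_natural C P Q \<eta> \<longleftrightarrow>
    (\<forall>\<Gamma>\<in>Obj C. \<eta> \<Gamma> \<in> Sec P \<Gamma> \<rightarrow> Sec Q \<Gamma>) \<and>
    (\<forall>\<Delta>\<in>Obj C. \<forall>\<Gamma>\<in>Obj C. \<forall>\<sigma>\<in>Hom C \<Delta> \<Gamma>. \<forall>x\<in>Sec P \<Gamma>.
      \<eta> \<Delta> (Act P \<sigma> x) = Act Q \<sigma> (\<eta> \<Gamma> x))"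

definition precomp :: "('o1 \<Rightarrow> 'o2) \<Rightarrow> ('m1 \<Rightarrow> 'm2) \<Rightarrow> ('o2, 'm2, 'x) presheaf \<Rightarrow> ('o1, 'm1, 'x) presheaf"
  where "precomp Fo Fa P = \<lparr>Sec = (\<lambda>X. Sec P (Fo X)), Act = (\<lambda>f. Act P (Fa f))\<rparr>"

definition yoneda :: "('o, 'm) category \<Rightarrow> 'o \<Rightarrow> ('o, 'm, 'm) presheaf"
  where "yoneda C \<Gamma> = \<lparr>Sec = (\<lambda>\<Delta>. Hom C \<Delta> \<Gamma>), Act = (\<lambda>\<sigma> \<tau>. Comp C \<tau> \<sigma>)\<rparr>"

definition yoneda_map :: "('o, 'm) category \<Rightarrow> 'm \<Rightarrow> 'o \<Rightarrow> 'm \<Rightarrow> 'm"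
  where "yoneda_map C f = (\<lambda>\<Delta> \<tau>. Comp C f \<tau>)"

text \<open>The map \<open>y(\<Gamma>) \<rightarrow> P\<close> that corresponds to \<open>x \<in> P(\<Gamma>)\<close> under the Yoneda lemma.\<close>

definition element_map :: "('o, 'm, 'x) presheaf \<Rightarrow> 'x \<Rightarrow> 'o \<Rightarrow> 'm \<Rightarrow> 'x"
  where "element_map P x = (\<lambda>\<Delta> \<sigma>. Act P \<sigma> x)"

text \<open>
  A commuting square with top \<open>f : P \<rightarrow> X\<close>, left \<open>g : P \<rightarrow> Y\<close>, right \<open>h : X \<rightarrow> Z\<close> and
  bottom \<open>k : Y \<rightarrow> Z\<close> is a pullback of presheaves; these are computed pointwise in sets.
\<close>

definition is_pullback ::
    "('o, 'm) category \<Rightarrow> ('o, 'm, 'p) presheaf \<Rightarrow> ('o, 'm, 'x) presheaf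
      \<Rightarrow> ('o, 'm, 'y) presheaf \<Rightarrow> ('o, 'm, 'z) presheaf
      \<Rightarrow> ('o \<Rightarrow> 'p \<Rightarrow> 'x) \<Rightarrow> ('o \<Rightarrow> 'p \<Rightarrow> 'y) \<Rightarrow> ('o \<Rightarrow> 'x \<Rightarrow> 'z) \<Rightarrow> ('o \<Rightarrow> 'y \<Rightarrow> 'z) \<Rightarrow> bool"
  where "is_pullback C P X Y Z f g h k \<longleftrightarrow>
    is_natural C P X f \<and> is_natural C P Y g \<and> is_natural C X Z h \<and> is_natural C Y Z k \<and>
    (\<forall>\<Delta>\<in>Obj C. \<forall>u\<in>Sec P \<Delta>. h \<Delta> (f \<Delta> u) = k \<Delta> (g \<Delta> u)) \<and>
    (\<forall>\<Delta>\<in>Obj C. \<forall>a\<in>Sec X \<Delta>. \<forall>b\<in>Sec Y \<Delta>. h \<Delta> a = k \<Delta> b \<longrightarrow>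
      (\<exists>!u. u \<in> Sec P \<Delta> \<and> f \<Delta> u = a \<and> g \<Delta> u = b))"


section \<open>Natural models\<close>

text \<open>\<open>Ty\<close>, \<open>Tm\<close>, \<open>tp\<close> are \<open>\<U>\<close>, \<open>\<U>\<close> with a dot, and \<open>p\<close>; \<open>ext \<Gamma> A\<close>, \<open>proj \<Gamma> A\<close>, \<open>var \<Gamma> A\<close>
  are \<open>\<Gamma>\<cdot>A\<close>, \<open>p\<^sub>A\<close>, \<open>q\<^sub>A\<close>.\<close>

record ('o, 'm, 'u, 't) nat_model =
  cat :: "('o, 'm) category"
  one :: "'o"
  Ty :: "('o, 'm, 'u) presheaf"
  Tm :: "('o, 'm, 't) presheaf"
  tp :: "'o \<Rightarrow> 't \<Rightarrow> 'u"
  ext :: "'o \<Rightarrow> 'u \<Rightarrow> 'o"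
  proj :: "'o \<Rightarrow> 'u \<Rightarrow> 'm"
  var :: "'o \<Rightarrow> 'u \<Rightarrow> 't"

locale natural_model =
  fixes M :: "('o, 'm, 'u, 't) nat_model"
  assumes category: "small_category (cat M)"
    and terminal: "is_terminal (cat M) (one M)"
    and Ty_presheaf: "is_presheaf (cat M) (Ty M)"
    and Tm_presheaf: "is_presheaf (cat M) (Tm M)"
    and tp_natural: "is_natural (cat M) (Tm M) (Ty M) (tp M)"
    and ext_Obj: "\<lbrakk>\<Gamma> \<in> Obj (cat M); A \<in> Sec (Ty M) \<Gamma>\<rbrakk> \<Longrightarrow> ext M \<Gamma> A \<in> Obj (cat M)"
    and proj_Hom: "\<lbrakk>\<Gamma> \<in> Obj (cat M); A \<in> Sec (Ty M) \<Gamma>\<rbrakk>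
      \<Longrightarrow> proj M \<Gamma> A \<in> Hom (cat M) (ext M \<Gamma> A) \<Gamma>"
    and var_Sec: "\<lbrakk>\<Gamma> \<in> Obj (cat M); A \<in> Sec (Ty M) \<Gamma>\<rbrakk>
      \<Longrightarrow> var M \<Gamma> A \<in> Sec (Tm M) (ext M \<Gamma> A)"
    and ext_pullback: "\<lbrakk>\<Gamma> \<in> Obj (cat M); A \<in> Sec (Ty M) \<Gamma>\<rbrakk> \<Longrightarrow>
      is_pullback (cat M)
        (yoneda (cat M) (ext M \<Gamma> A)) (Tm M) (yoneda (cat M) \<Gamma>) (Ty M)
        (element_map (Tm M) (var M \<Gamma> A)) (yoneda_map (cat M) (proj M \<Gamma> A))
        (tp M) (element_map (Ty M) A)"

definition Tm_of :: "('o, 'm, 'u, 't) nat_model \<Rightarrow> 'o \<Rightarrow> 'u \<Rightarrow> 't set"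
  where "Tm_of M \<Gamma> A = {a \<in> Sec (Tm M) \<Gamma>. tp M \<Gamma> a = A}"

definition to_one :: "('o, 'm, 'u, 't) nat_model \<Rightarrow> 'o \<Rightarrow> 'm"
  where "to_one M \<Gamma> = (THE f. f \<in> Hom (cat M) \<Gamma> (one M))"

text \<open>\<open>lift M \<sigma> A\<close> is \<open>\<sigma>\<cdot>A : \<Delta>\<cdot>A[\<sigma>] \<rightarrow> \<Gamma>\<cdot>A\<close> for \<open>\<sigma> : \<Delta> \<rightarrow> \<Gamma>\<close> and \<open>A \<in> \<U>(\<Gamma>)\<close>.\<close>

definition lift :: "('o, 'm, 'u, 't) nat_model \<Rightarrow> 'm \<Rightarrow> 'u \<Rightarrow> 'm"
  where "lift M \<sigma> A =
    (let \<Delta> = Dom (cat M) \<sigma>; \<Gamma> = Cod (cat M) \<sigma>; A' = Act (Ty M) \<sigma> A in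
      (THE \<tau>. \<tau> \<in> Hom (cat M) (ext M \<Delta> A') (ext M \<Gamma> A) \<and>
        Comp (cat M) (proj M \<Gamma> A) \<tau> = Comp (cat M) \<sigma> (proj M \<Delta> A') \<and>
        Act (Tm M) \<tau> (var M \<Gamma> A) = var M \<Delta> A'))"

record ('o1, 'm1, 'u1, 't1, 'o2, 'm2, 'u2, 't2) nat_model_map =
  on_obj :: "'o1 \<Rightarrow> 'o2"
  on_arr :: "'m1 \<Rightarrow> 'm2"
  on_ty :: "'o1 \<Rightarrow> 'u1 \<Rightarrow> 'u2"
  on_tm :: "'o1 \<Rightarrow> 't1 \<Rightarrow> 't2"

locale nat_model_morphism =
  dom: natural_model M + cod: natural_model N
  for M :: "('o1, 'm1, 'u1, 't1) nat_model" and N :: "('o2, 'm2, 'u2, 't2) nat_model" +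
  fixes F :: "('o1, 'm1, 'u1, 't1, 'o2, 'm2, 'u2, 't2) nat_model_map"
  assumes is_functor: "is_functor (cat M) (cat N) (on_obj F) (on_arr F)"
    and pres_one: "on_obj F (one M) = one N"
    and on_ty_natural:
      "is_natural (cat M) (Ty M) (precomp (on_obj F) (on_arr F) (Ty N)) (on_ty F)"
    and on_tm_natural:
      "is_natural (cat M) (Tm M) (precomp (on_obj F) (on_arr F) (Tm N)) (on_tm F)"
    and pres_tp: "\<lbrakk>\<Gamma> \<in> Obj (cat M); a \<in> Sec (Tm M) \<Gamma>\<rbrakk>
      \<Longrightarrow> tp N (on_obj F \<Gamma>) (on_tm F \<Gamma> a) = on_ty F \<Gamma> (tp M \<Gamma> a)"
    and pres_ext: "\<lbrakk>\<Gamma> \<in> Obj (cat M); A \<in> Sec (Ty M) \<Gamma>\<rbrakk>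
      \<Longrightarrow> on_obj F (ext M \<Gamma> A) = ext N (on_obj F \<Gamma>) (on_ty F \<Gamma> A)"
    and pres_proj: "\<lbrakk>\<Gamma> \<in> Obj (cat M); A \<in> Sec (Ty M) \<Gamma>\<rbrakk>
      \<Longrightarrow> on_arr F (proj M \<Gamma> A) = proj N (on_obj F \<Gamma>) (on_ty F \<Gamma> A)"
    and pres_var: "\<lbrakk>\<Gamma> \<in> Obj (cat M); A \<in> Sec (Ty M) \<Gamma>\<rbrakk>
      \<Longrightarrow> on_tm F (ext M \<Gamma> A) (var M \<Gamma> A) = var N (on_obj F \<Gamma>) (on_ty F \<Gamma> A)"

definition model_map_comp ::
    "('o2, 'm2, 'u2, 't2, 'o3, 'm3, 'u3, 't3) nat_model_map
      \<Rightarrow> ('o1, 'm1, 'u1, 't1, 'o2, 'm2, 'u2, 't2) nat_model_map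
      \<Rightarrow> ('o1, 'm1, 'u1, 't1, 'o3, 'm3, 'u3, 't3) nat_model_map"
  where "model_map_comp G F =
    \<lparr>on_obj = (\<lambda>\<Gamma>. on_obj G (on_obj F \<Gamma>)),
     on_arr = (\<lambda>\<sigma>. on_arr G (on_arr F \<sigma>)),
     on_ty = (\<lambda>\<Gamma> A. on_ty G (on_obj F \<Gamma>) (on_ty F \<Gamma> A)),
     on_tm = (\<lambda>\<Gamma> a. on_tm G (on_obj F \<Gamma>) (on_tm F \<Gamma> a))\<rparr>"

text \<open>Equality of maps out of \<open>M\<close>: the values of the underlying HOL functions outside the
  carriers of \<open>M\<close> are irrelevant.\<close>

definition model_map_eq ::
    "('o1, 'm1, 'u1, 't1) nat_model
      \<Rightarrow> ('o1, 'm1, 'u1, 't1, 'o2, 'm2, 'u2, 't2) nat_model_map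
      \<Rightarrow> ('o1, 'm1, 'u1, 't1, 'o2, 'm2, 'u2, 't2) nat_model_map \<Rightarrow> bool"
  where "model_map_eq M F G \<longleftrightarrow>
    (\<forall>\<Gamma>\<in>Obj (cat M). on_obj F \<Gamma> = on_obj G \<Gamma>) \<and>
    (\<forall>\<sigma>\<in>Arr (cat M). on_arr F \<sigma> = on_arr G \<sigma>) \<and>
    (\<forall>\<Gamma>\<in>Obj (cat M). \<forall>A\<in>Sec (Ty M) \<Gamma>. on_ty F \<Gamma> A = on_ty G \<Gamma> A) \<and>
    (\<forall>\<Gamma>\<in>Obj (cat M). \<forall>a\<in>Sec (Tm M) \<Gamma>. on_tm F \<Gamma> a = on_tm G \<Gamma> a)"


section \<open>Adjoining a term \<open>x : O\<close>\<close>

text \<open>The type \<open>O\<close> is written \<open>O'\<close> below, as \<open>O\<close> is reserved for relation composition.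
  \<open>wk M O' \<Gamma>\<close> is \<open>O[t\<^sub>\<Gamma>]\<close>; then its context extension and projection.\<close>

definition wk :: "('o, 'm, 'u, 't) nat_model \<Rightarrow> 'u \<Rightarrow> 'o \<Rightarrow> 'u"
  where "wk M O' \<Gamma> = Act (Ty M) (to_one M \<Gamma>) O'"

definition extO :: "('o, 'm, 'u, 't) nat_model \<Rightarrow> 'u \<Rightarrow> 'o \<Rightarrow> 'o"
  where "extO M O' \<Gamma> = ext M \<Gamma> (wk M O' \<Gamma>)"

definition projO :: "('o, 'm, 'u, 't) nat_model \<Rightarrow> 'u \<Rightarrow> 'o \<Rightarrow> 'm"
  where "projO M O' \<Gamma> = proj M \<Gamma> (wk M O' \<Gamma>)"

text \<open>\<open>\<sigma>\<cdot>O : \<Delta>\<cdot>O \<rightarrow> \<Gamma>\<cdot>O\<close> for \<open>\<sigma> : \<Delta> \<rightarrow> \<Gamma>\<close>.\<close>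

definition liftO :: "('o, 'm, 'u, 't) nat_model \<Rightarrow> 'u \<Rightarrow> 'm \<Rightarrow> 'm"
  where "liftO M O' \<sigma> = lift M \<sigma> (wk M O' (Cod (cat M) \<sigma>))"

text \<open>\<open>sw : \<Gamma>\<cdot>O\<cdot>A[p\<^sub>O] \<rightarrow> \<Gamma>\<cdot>A\<cdot>O\<close> for \<open>A \<in> \<U>(\<Gamma>)\<close>.\<close>

definition swap :: "('o, 'm, 'u, 't) nat_model \<Rightarrow> 'u \<Rightarrow> 'o \<Rightarrow> 'u \<Rightarrow> 'm"
  where "swap M O' \<Gamma> A =
    (let A' = Act (Ty M) (projO M O' \<Gamma>) A in
      (THE s. s \<in> Hom (cat M) (ext M (extO M O' \<Gamma>) A') (extO M O' (ext M \<Gamma> A)) \<and>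
        Comp (cat M) (projO M O' (ext M \<Gamma> A)) s = lift M (projO M O' \<Gamma>) A \<and>
        Comp (cat M) (liftO M O' (proj M \<Gamma> A)) s = proj M (extO M O' \<Gamma>) A'))"

fun is_telescope :: "('o, 'm, 'u, 't) nat_model \<Rightarrow> 'o \<Rightarrow> 'u list \<Rightarrow> bool"
  where
    "is_telescope M \<Delta> [] \<longleftrightarrow> True"
  | "is_telescope M \<Delta> (A # As) \<longleftrightarrow> A \<in> Sec (Ty M) \<Delta> \<and> is_telescope M (ext M \<Delta> A) As"

fun ext_list :: "('o, 'm, 'u, 't) nat_model \<Rightarrow> 'o \<Rightarrow> 'u list \<Rightarrow> 'o"
  where
    "ext_list M \<Delta> [] = \<Delta>"
  | "ext_list M \<Delta> (A # As) = ext_list M (ext M \<Delta> A) As"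

fun proj_list :: "('o, 'm, 'u, 't) nat_model \<Rightarrow> 'o \<Rightarrow> 'u list \<Rightarrow> 'm"
  where
    "proj_list M \<Delta> [] = Id (cat M) \<Delta>"
  | "proj_list M \<Delta> (A # As) = Comp (cat M) (proj M \<Delta> A) (proj_list M (ext M \<Delta> A) As)"

definition is_weakened :: "('o, 'm, 'u, 't) nat_model \<Rightarrow> 'u \<Rightarrow> 'o \<Rightarrow> 'u \<Rightarrow> bool"
  where "is_weakened M O' \<Gamma> B \<longleftrightarrow> (\<exists>A\<in>Sec (Ty M) \<Gamma>. Act (Ty M) (projO M O' \<Gamma>) A = B)"

text \<open>A type \<open>A'\<close> over \<open>\<Gamma>\<close> with \<open>A'[p\<^sub>O] = B\<close>. It need not be unique for an arbitrary \<open>M\<close>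
  (weakening along \<open>O\<close> may fail to be injective), in which case one is chosen.\<close>

definition strengthen :: "('o, 'm, 'u, 't) nat_model \<Rightarrow> 'u \<Rightarrow> 'o \<Rightarrow> 'u \<Rightarrow> 'u"
  where "strengthen M O' \<Gamma> B =
    (SOME A. A \<in> Sec (Ty M) \<Gamma> \<and> Act (Ty M) (projO M O' \<Gamma>) A = B)"

text \<open>
  Objects \<open>(\<Gamma>; A\<^sub>1, \<dots>, A\<^sub>n)\<close> up to the identification of \<open>(\<Gamma>\<cdot>A; A\<^sub>1, \<dots>, A\<^sub>n)\<close> with
  \<open>(\<Gamma>; A[p\<^sub>O], A\<^sub>1, \<dots>, A\<^sub>n)\<close> are represented by their normal forms, that is, by the lists
  to which this identification cannot be applied from right to left.
\<close>

definition free_Obj :: "('o, 'm, 'u, 't) nat_model \<Rightarrow> 'u \<Rightarrow> ('o \<times> 'u list) set"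
  where "free_Obj M O' =
    {(\<Gamma>, As). \<Gamma> \<in> Obj (cat M) \<and> is_telescope M (extO M O' \<Gamma>) As \<and>
      (As \<noteq> [] \<longrightarrow> \<not> is_weakened M O' \<Gamma> (hd As))}"

text \<open>\<open>\<Gamma>\<cdot>O\<cdot>A\<^sub>1\<cdots>A\<^sub>n\<close> and its canonical morphism to \<open>\<diamond>\<cdot>O\<close>.\<close>

definition total :: "('o, 'm, 'u, 't) nat_model \<Rightarrow> 'u \<Rightarrow> 'o \<times> 'u list \<Rightarrow> 'o"
  where "total M O' X = ext_list M (extO M O' (fst X)) (snd X)"

definition canonical :: "('o, 'm, 'u, 't) nat_model \<Rightarrow> 'u \<Rightarrow> 'o \<times> 'u list \<Rightarrow> 'm"
  where "canonical M O' X =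
    Comp (cat M) (lift M (to_one M (fst X)) O') (proj_list M (extO M O' (fst X)) (snd X))"

text \<open>An arrow \<open>(X, f, Y)\<close> is the morphism \<open>f\<close> tagged with its source \<open>X\<close> and target \<open>Y\<close>,
  since distinct objects may have the same \<open>total\<close>.\<close>

type_synonym ('o, 'm, 'u) free_arr = "('o \<times> 'u list) \<times> 'm \<times> ('o \<times> 'u list)"

definition free_cat ::
    "('o, 'm, 'u, 't) nat_model \<Rightarrow> 'u \<Rightarrow> ('o \<times> 'u list, ('o, 'm, 'u) free_arr) category"
  where "free_cat M O' =
    \<lparr>Obj = free_Obj M O',
     Arr = {(X, f, Y). X \<in> free_Obj M O' \<and> Y \<in> free_Obj M O' \<and>
       f \<in> Hom (cat M) (total M O' X) (total M O' Y) \<and>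
       Comp (cat M) (canonical M O' Y) f = canonical M O' X},
     Dom = (\<lambda>(X, f, Y). X),
     Cod = (\<lambda>(X, f, Y). Y),
     Id = (\<lambda>X. (X, Id (cat M) (total M O' X), X)),
     Comp = (\<lambda>(Y', g, Z) (X, f, Y). (X, Comp (cat M) g f, Z))\<rparr>"

definition free_ext :: "('o, 'm, 'u, 't) nat_model \<Rightarrow> 'u \<Rightarrow> 'o \<times> 'u list \<Rightarrow> 'u \<Rightarrow> 'o \<times> 'u list"
  where "free_ext M O' = (\<lambda>(\<Gamma>, As) A.
    if As = [] \<and> is_weakened M O' \<Gamma> A then (ext M \<Gamma> (strengthen M O' \<Gamma> A), [])
    else (\<Gamma>, As @ [A]))"

definition free_proj ::
    "('o, 'm, 'u, 't) nat_model \<Rightarrow> 'u \<Rightarrow> 'o \<times> 'u list \<Rightarrow> 'u \<Rightarrow> ('o, 'm, 'u) free_arr"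
  where "free_proj M O' = (\<lambda>(\<Gamma>, As) A.
    (free_ext M O' (\<Gamma>, As) A,
     if As = [] \<and> is_weakened M O' \<Gamma> A
     then Comp (cat M) (proj M (extO M O' \<Gamma>) A)
       (inverse_arr (cat M) (swap M O' \<Gamma> (strengthen M O' \<Gamma> A)))
     else proj M (total M O' (\<Gamma>, As)) A,
     (\<Gamma>, As)))"

definition free_var :: "('o, 'm, 'u, 't) nat_model \<Rightarrow> 'u \<Rightarrow> 'o \<times> 'u list \<Rightarrow> 'u \<Rightarrow> 't"
  where "free_var M O' = (\<lambda>(\<Gamma>, As) A.
    if As = [] \<and> is_weakened M O' \<Gamma> A
    then Act (Tm M) (inverse_arr (cat M) (swap M O' \<Gamma> (strengthen M O' \<Gamma> A)))
      (var M (extO M O' \<Gamma>) A)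
    else var M (total M O' (\<Gamma>, As)) A)"

definition free_model ::
    "('o, 'm, 'u, 't) nat_model \<Rightarrow> 'u \<Rightarrow> ('o \<times> 'u list, ('o, 'm, 'u) free_arr, 'u, 't) nat_model"
  where "free_model M O' =
    \<lparr>cat = free_cat M O',
     one = (one M, []),
     Ty = precomp (total M O') (\<lambda>(X, f, Y). f) (Ty M),
     Tm = precomp (total M O') (\<lambda>(X, f, Y). f) (Tm M),
     tp = (\<lambda>X. tp M (total M O' X)),
     ext = free_ext M O',
     proj = free_proj M O',
     var = free_var M O'\<rparr>"

text \<open>The distinguished term \<open>x\<close>, over the object \<open>(\<diamond>)\<close>.\<close>

definition free_term :: "('o, 'm, 'u, 't) nat_model \<Rightarrow> 'u \<Rightarrow> 't"
  where "free_term M O' = var M (one M) O'"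

definition inclusion ::
    "('o, 'm, 'u, 't) nat_model \<Rightarrow> 'u \<Rightarrow>
      ('o, 'm, 'u, 't, 'o \<times> 'u list, ('o, 'm, 'u) free_arr, 'u, 't) nat_model_map"
  where "inclusion M O' =
    \<lparr>on_obj = (\<lambda>\<Gamma>. (\<Gamma>, [])),
     on_arr = (\<lambda>\<sigma>. ((Dom (cat M) \<sigma>, []), liftO M O' \<sigma>, (Cod (cat M) \<sigma>, []))),
     on_ty = (\<lambda>\<Gamma> A. Act (Ty M) (projO M O' \<Gamma>) A),
     on_tm = (\<lambda>\<Gamma> a. Act (Tm M) (projO M O' \<Gamma>) a)\<rparr>"

end

theory Submission imports Defs begin

text \<open>
  Composing the inclusion with \<open>\<langle>id, x\<rangle> : X \<rightarrow> I (total X)\<close> recovers every type and term over \<open>X\<close> from its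
  weakening, so \<open>F\<^sup>\<sharp>\<close> must send \<open>A\<close> over \<open>X\<close> to \<open>(FA)[s]\<close>, where \<open>s = F\<^sup>\<sharp> \<langle>id, x\<rangle>\<close>. On objects \<open>(\<Gamma>)\<close>,
  \<open>s\<close> has to be the section \<open>\<langle>id, o\<rangle>\<close> of \<open>F\<Gamma>\<cdot>FO \<rightarrow> F\<Gamma>\<close>, and extending the list by \<open>A\<close> lifts \<open>s\<close> to \<open>s\<cdot>FA\<close>;
  this recursion determines \<open>F\<^sup>\<sharp>\<close> on objects. Each \<open>s : F\<^sup>\<sharp> X \<rightarrow> F (total X)\<close> is the pullback of \<open>o\<close> along
  \<open>F (total X) \<rightarrow> \<star>\<cdot>FO\<close>, so a morphism over \<open>\<diamond>\<cdot>O\<close> has exactly one image compatible with these sections.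
\<close>

text \<open>Behind \<langle>id, x\<rangle> stands an adjunction: \<open>total\<close> is left
  adjoint to \<open>I\<close>, with unit \<langle>id, x\<rangle> (\<open>diag\<close>) and counit
  \<open>p\<^sub>O\<close> (\<open>projO\<close>). A morphism extending F is natural at every unit,
  which settles types, terms and arrows once the image \<open>s\<close> of the unit is known; the
  triangle identity at \<open>I\<close> makes \<open>s\<close> a section over the objects
  (\<Gamma>). The delicate point is strictness. Extending (\<Gamma>) by a weakened type collapses to
  the normal form (\<Gamma>\<cdot>A), reached through \<open>sw\<close> and an arbitrary choice of
  A, and the image of this extension has to be F\<Gamma>\<cdot>FA on the nose. It is, because
  \<open>s\<close> is a section: restricting F(\<open>A[p\<^sub>O]\<close>) along \<open>s\<close>
  gives FA. The same equation shows that FA depends on \<open>A[p\<^sub>O]\<close> alone, so the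
  choice in \<open>strengthen\<close> is harmless. Commuting with the maps to \<diamond>\<cdot>O is
  handled through a single term \<open>gen\<close>, the weakening of x.\<close>

abbreviation comp_in :: "('o, 'm, 'u, 't) nat_model \<Rightarrow> 'm \<Rightarrow> 'm \<Rightarrow> 'm"  ("(_ \<odot>\<index>/ _)" [66, 65] 65)
  where "g \<odot>\<^bsub>M\<^esub> f \<equiv> Comp (cat M) g f"

section \<open>Natural models\<close>

lemma (in small_category) Hom_Obj:
  assumes "f \<in> Hom C X Y"
  shows Hom_Obj_dom: "X \<in> Obj C" and Hom_Obj_cod: "Y \<in> Obj C"
  using assms Dom_closed Cod_closed by (auto simp: Hom_def)

lemma
  assumes "f \<in> Hom C X Y"
  shows Hom_Dom: "Dom C f = X" and Hom_Cod: "Cod C f = Y"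
  using assms by (auto simp: Hom_def)

lemma Arr_Hom: "f \<in> Arr C \<Longrightarrow> f \<in> Hom C (Dom C f) (Cod C f)"
  by (simp add: Hom_def)

text \<open>The map \<langle>\<sigma>, a\<rangle> into \<Gamma>\<cdot>A. Its source is read off as
  the domain of \<sigma>, and the description is meaningful when a has type A[\<sigma>].\<close>

definition pair :: "('o, 'm, 'u, 't) nat_model \<Rightarrow> 'o \<Rightarrow> 'm \<Rightarrow> 'u \<Rightarrow> 't \<Rightarrow> 'm"
  where "pair M \<Gamma> \<sigma> A a = (THE u. u \<in> Hom (cat M) (Dom (cat M) \<sigma>) (ext M \<Gamma> A) \<and>
    proj M \<Gamma> A \<odot>\<^bsub>M\<^esub> u = \<sigma> \<and> Act (Tm M) u (var M \<Gamma> A) = a)"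

context natural_model
begin

sublocale small_category "cat M"
  by (rule category)

lemma Ty_Act:
  assumes "\<sigma> \<in> Hom (cat M) \<Delta> \<Gamma>" "A \<in> Sec (Ty M) \<Gamma>"
  shows "Act (Ty M) \<sigma> A \<in> Sec (Ty M) \<Delta>"
  using Ty_presheaf assms Hom_Obj[OF assms(1)] unfolding is_presheaf_def by blast

lemma Ty_Id: "\<Gamma> \<in> Obj (cat M) \<Longrightarrow> A \<in> Sec (Ty M) \<Gamma> \<Longrightarrow> Act (Ty M) (Id (cat M) \<Gamma>) A = A"
  using Ty_presheaf unfolding is_presheaf_def by blast

lemma Ty_Comp:
  assumes "\<tau> \<in> Hom (cat M) \<Theta> \<Delta>" "\<sigma> \<in> Hom (cat M) \<Delta> \<Gamma>" "A \<in> Sec (Ty M) \<Gamma>"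
  shows "Act (Ty M) (\<sigma> \<odot>\<^bsub>M\<^esub> \<tau>) A = Act (Ty M) \<tau> (Act (Ty M) \<sigma> A)"
  using Ty_presheaf assms Hom_Obj[OF assms(1)] Hom_Obj[OF assms(2)]
  unfolding is_presheaf_def by blast

lemma Tm_Act:
  assumes "\<sigma> \<in> Hom (cat M) \<Delta> \<Gamma>" "a \<in> Sec (Tm M) \<Gamma>"
  shows "Act (Tm M) \<sigma> a \<in> Sec (Tm M) \<Delta>"
  using Tm_presheaf assms Hom_Obj[OF assms(1)] unfolding is_presheaf_def by blast

lemma Tm_Id: "\<Gamma> \<in> Obj (cat M) \<Longrightarrow> a \<in> Sec (Tm M) \<Gamma> \<Longrightarrow> Act (Tm M) (Id (cat M) \<Gamma>) a = a"
  using Tm_presheaf unfolding is_presheaf_def by blast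

lemma Tm_Comp:
  assumes "\<tau> \<in> Hom (cat M) \<Theta> \<Delta>" "\<sigma> \<in> Hom (cat M) \<Delta> \<Gamma>" "a \<in> Sec (Tm M) \<Gamma>"
  shows "Act (Tm M) (\<sigma> \<odot>\<^bsub>M\<^esub> \<tau>) a = Act (Tm M) \<tau> (Act (Tm M) \<sigma> a)"
  using Tm_presheaf assms Hom_Obj[OF assms(1)] Hom_Obj[OF assms(2)]
  unfolding is_presheaf_def by blast

lemma tp_Sec: "\<Gamma> \<in> Obj (cat M) \<Longrightarrow> a \<in> Sec (Tm M) \<Gamma> \<Longrightarrow> tp M \<Gamma> a \<in> Sec (Ty M) \<Gamma>"
  using tp_natural unfolding is_natural_def by blast

lemma tp_Act:
  assumes "\<sigma> \<in> Hom (cat M) \<Delta> \<Gamma>" "a \<in> Sec (Tm M) \<Gamma>"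
  shows "tp M \<Delta> (Act (Tm M) \<sigma> a) = Act (Ty M) \<sigma> (tp M \<Gamma> a)"
  using tp_natural assms Hom_Obj[OF assms(1)] unfolding is_natural_def by blast

text \<open>The comprehension square evaluated at the identity of \<Gamma>\<cdot>A, the Yoneda form
  of its commutativity.\<close>

lemma tp_var:
  assumes "\<Gamma> \<in> Obj (cat M)" "A \<in> Sec (Ty M) \<Gamma>"
  shows "tp M (ext M \<Gamma> A) (var M \<Gamma> A) = Act (Ty M) (proj M \<Gamma> A) A"
proof -
  have E: "ext M \<Gamma> A \<in> Obj (cat M)" using ext_Obj assms .
  then have "Id (cat M) (ext M \<Gamma> A) \<in> Sec (yoneda (cat M) (ext M \<Gamma> A)) (ext M \<Gamma> A)"
    by (simp add: yoneda_def Id_Hom)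
  with ext_pullback[OF assms] E
  have "tp M (ext M \<Gamma> A) (element_map (Tm M) (var M \<Gamma> A) (ext M \<Gamma> A) (Id (cat M) (ext M \<Gamma> A))) =
      element_map (Ty M) A (ext M \<Gamma> A) (yoneda_map (cat M) (proj M \<Gamma> A) (ext M \<Gamma> A) (Id (cat M) (ext M \<Gamma> A)))"
    unfolding is_pullback_def by blast
  then show ?thesis
    by (simp add: element_map_def yoneda_map_def Tm_Id[OF E var_Sec[OF assms]]
        Comp_Id_right[OF proj_Hom[OF assms]])
qed

text \<open>Pullbacks of presheaves are computed pointwise, so the comprehension square unfolds into
  a property of single maps and terms.\<close>

lemma ext_universal:
  assumes G: "\<Gamma> \<in> Obj (cat M)" "A \<in> Sec (Ty M) \<Gamma>" and s: "\<sigma> \<in> Hom (cat M) \<Delta> \<Gamma>"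
    and a: "a \<in> Sec (Tm M) \<Delta>" "tp M \<Delta> a = Act (Ty M) \<sigma> A"
  shows "\<exists>!u. u \<in> Hom (cat M) \<Delta> (ext M \<Gamma> A) \<and>
    proj M \<Gamma> A \<odot>\<^bsub>M\<^esub> u = \<sigma> \<and> Act (Tm M) u (var M \<Gamma> A) = a"
proof -
  have "\<exists>!u. u \<in> Sec (yoneda (cat M) (ext M \<Gamma> A)) \<Delta> \<and>
      element_map (Tm M) (var M \<Gamma> A) \<Delta> u = a \<and> yoneda_map (cat M) (proj M \<Gamma> A) \<Delta> u = \<sigma>"
    using ext_pullback[OF G] Hom_Obj_dom[OF s] a s unfolding is_pullback_def
    by (auto simp: yoneda_def element_map_def yoneda_map_def)
  then show ?thesis
    by (auto simp: yoneda_def element_map_def yoneda_map_def)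
qed

lemma
  assumes "\<Gamma> \<in> Obj (cat M)" "A \<in> Sec (Ty M) \<Gamma>" "\<sigma> \<in> Hom (cat M) \<Delta> \<Gamma>"
    "a \<in> Sec (Tm M) \<Delta>" "tp M \<Delta> a = Act (Ty M) \<sigma> A"
  shows pair_Hom: "pair M \<Gamma> \<sigma> A a \<in> Hom (cat M) \<Delta> (ext M \<Gamma> A)"
    and proj_pair: "proj M \<Gamma> A \<odot>\<^bsub>M\<^esub> pair M \<Gamma> \<sigma> A a = \<sigma>"
    and var_pair: "Act (Tm M) (pair M \<Gamma> \<sigma> A a) (var M \<Gamma> A) = a"
  using theI'[OF ext_universal[OF assms]] unfolding pair_def Hom_Dom[OF assms(3)] by auto

text \<open>\<open>p\<^sub>A\<close> and \<open>q\<^sub>A\<close> are jointly monic: both maps solve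
  the pullback problem posed by the components of v.\<close>

lemma ext_eqI:
  assumes G: "\<Gamma> \<in> Obj (cat M)" "A \<in> Sec (Ty M) \<Gamma>"
    and u: "u \<in> Hom (cat M) \<Delta> (ext M \<Gamma> A)" and v: "v \<in> Hom (cat M) \<Delta> (ext M \<Gamma> A)"
    and "proj M \<Gamma> A \<odot>\<^bsub>M\<^esub> u = proj M \<Gamma> A \<odot>\<^bsub>M\<^esub> v"
    and "Act (Tm M) u (var M \<Gamma> A) = Act (Tm M) v (var M \<Gamma> A)"
  shows "u = v"
proof -
  have "proj M \<Gamma> A \<odot>\<^bsub>M\<^esub> v \<in> Hom (cat M) \<Delta> \<Gamma>"
    by (rule Comp_Hom[OF v proj_Hom[OF G]])
  moreover have "Act (Tm M) v (var M \<Gamma> A) \<in> Sec (Tm M) \<Delta>"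
    by (rule Tm_Act[OF v var_Sec[OF G]])
  moreover have "tp M \<Delta> (Act (Tm M) v (var M \<Gamma> A)) = Act (Ty M) (proj M \<Gamma> A \<odot>\<^bsub>M\<^esub> v) A"
    by (simp add: tp_Act[OF v var_Sec[OF G]] tp_var[OF G] Ty_Comp[OF v proj_Hom[OF G] G(2)])
  ultimately show ?thesis
    using ext_universal[OF G, of "proj M \<Gamma> A \<odot>\<^bsub>M\<^esub> v" \<Delta> "Act (Tm M) v (var M \<Gamma> A)"] assms by blast
qed

lemma to_one_Hom: "\<Gamma> \<in> Obj (cat M) \<Longrightarrow> to_one M \<Gamma> \<in> Hom (cat M) \<Gamma> (one M)"
  using terminal unfolding is_terminal_def to_one_def by (metis theI')

lemma to_one_unique: "f \<in> Hom (cat M) \<Gamma> (one M) \<Longrightarrow> f = to_one M \<Gamma>"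
  using terminal to_one_Hom Hom_Obj_dom unfolding is_terminal_def by blast

lemma one_Obj: "one M \<in> Obj (cat M)"
  using terminal unfolding is_terminal_def by blast

lemma to_one_Comp: "\<sigma> \<in> Hom (cat M) \<Delta> \<Gamma> \<Longrightarrow> to_one M \<Gamma> \<odot>\<^bsub>M\<^esub> \<sigma> = to_one M \<Delta>"
  by (rule to_one_unique) (metis Comp_Hom Hom_Obj_cod to_one_Hom)

lemma to_one_one: "to_one M (one M) = Id (cat M) (one M)"
  using to_one_unique[OF Id_Hom[OF one_Obj]] by simp

lemma
  assumes s: "\<sigma> \<in> Hom (cat M) \<Delta> \<Gamma>" and A: "A \<in> Sec (Ty M) \<Gamma>"
  shows lift_Hom: "lift M \<sigma> A \<in> Hom (cat M) (ext M \<Delta> (Act (Ty M) \<sigma> A)) (ext M \<Gamma> A)"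
    and proj_lift: "proj M \<Gamma> A \<odot>\<^bsub>M\<^esub> lift M \<sigma> A = \<sigma> \<odot>\<^bsub>M\<^esub> proj M \<Delta> (Act (Ty M) \<sigma> A)"
    and var_lift: "Act (Tm M) (lift M \<sigma> A) (var M \<Gamma> A) = var M \<Delta> (Act (Ty M) \<sigma> A)"
proof -
  note D = Hom_Obj_dom[OF s] Ty_Act[OF s A]
  have "\<exists>!\<tau>. \<tau> \<in> Hom (cat M) (ext M \<Delta> (Act (Ty M) \<sigma> A)) (ext M \<Gamma> A) \<and>
      proj M \<Gamma> A \<odot>\<^bsub>M\<^esub> \<tau> = \<sigma> \<odot>\<^bsub>M\<^esub> proj M \<Delta> (Act (Ty M) \<sigma> A) \<and>
      Act (Tm M) \<tau> (var M \<Gamma> A) = var M \<Delta> (Act (Ty M) \<sigma> A)"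
  proof (rule ext_universal)
    show "\<sigma> \<odot>\<^bsub>M\<^esub> proj M \<Delta> (Act (Ty M) \<sigma> A) \<in> Hom (cat M) (ext M \<Delta> (Act (Ty M) \<sigma> A)) \<Gamma>"
      by (rule Comp_Hom[OF proj_Hom[OF D] s])
  qed (simp_all add: Hom_Obj_cod[OF s] A var_Sec[OF D] tp_var[OF D] Ty_Comp[OF proj_Hom[OF D] s A])
  from theI'[OF this]
  show "lift M \<sigma> A \<in> Hom (cat M) (ext M \<Delta> (Act (Ty M) \<sigma> A)) (ext M \<Gamma> A)"
    and "proj M \<Gamma> A \<odot>\<^bsub>M\<^esub> lift M \<sigma> A = \<sigma> \<odot>\<^bsub>M\<^esub> proj M \<Delta> (Act (Ty M) \<sigma> A)"
    and "Act (Tm M) (lift M \<sigma> A) (var M \<Gamma> A) = var M \<Delta> (Act (Ty M) \<sigma> A)"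
    unfolding lift_def Let_def Hom_Dom[OF s] Hom_Cod[OF s] by auto
qed

lemma ext_list_Obj:
  "\<Delta> \<in> Obj (cat M) \<Longrightarrow> is_telescope M \<Delta> As \<Longrightarrow> ext_list M \<Delta> As \<in> Obj (cat M)"
  by (induction As arbitrary: \<Delta>) (auto simp: ext_Obj)

lemma proj_list_Hom:
  "\<Delta> \<in> Obj (cat M) \<Longrightarrow> is_telescope M \<Delta> As \<Longrightarrow>
    proj_list M \<Delta> As \<in> Hom (cat M) (ext_list M \<Delta> As) \<Delta>"
  by (induction As arbitrary: \<Delta>) (auto simp: ext_Obj Id_Hom intro!: Comp_Hom[OF _ proj_Hom])

text \<open>The recursive functions peel types off the front of a list, while extension in the free
  model appends at the end; the \<open>snoc\<close> lemmas mediate.\<close>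

lemma ext_list_snoc: "ext_list M \<Delta> (As @ [A]) = ext M (ext_list M \<Delta> As) A"
  by (induction As arbitrary: \<Delta>) auto

lemma is_telescope_snoc:
  "is_telescope M \<Delta> (As @ [A]) \<longleftrightarrow> is_telescope M \<Delta> As \<and> A \<in> Sec (Ty M) (ext_list M \<Delta> As)"
  by (induction As arbitrary: \<Delta>) auto

lemma proj_list_snoc:
  "\<Delta> \<in> Obj (cat M) \<Longrightarrow> is_telescope M \<Delta> (As @ [A]) \<Longrightarrow>
    proj_list M \<Delta> (As @ [A]) = proj_list M \<Delta> As \<odot>\<^bsub>M\<^esub> proj M (ext_list M \<Delta> As) A"
proof (induction As arbitrary: \<Delta>)
  case Nil
  then show ?case
    by (simp add: Comp_Id_left[OF proj_Hom] Comp_Id_right[OF proj_Hom])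
next
  case (Cons B Bs)
  then have B: "B \<in> Sec (Ty M) \<Delta>" and t: "is_telescope M (ext M \<Delta> B) Bs"
    and A: "A \<in> Sec (Ty M) (ext_list M (ext M \<Delta> B) Bs)"
    by (auto simp: is_telescope_snoc)
  note E = ext_Obj[OF Cons.prems(1) B]
  show ?case
    using Cons Comp_assoc[OF proj_Hom[OF ext_list_Obj[OF E t] A] proj_list_Hom[OF E t]
        proj_Hom[OF Cons.prems(1) B]]
    by (simp add: E)
qed

end

section \<open>The model with a term adjoined\<close>

locale term_extension = natural_model M
  for M :: "('o, 'm, 'u, 't) nat_model" +
  fixes O' :: 'u
  assumes O'_Sec: "O' \<in> Sec (Ty M) (one M)"
begin

section \<open>Adjoining a variable of type \<open>O\<close> to a context\<close>

lemma wk_Sec: "\<Gamma> \<in> Obj (cat M) \<Longrightarrow> wk M O' \<Gamma> \<in> Sec (Ty M) \<Gamma>"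
  unfolding wk_def by (rule Ty_Act[OF to_one_Hom O'_Sec])

text \<open>Strict stability comes from terminality, since \<open>t\<^sub>\<Gamma>\<close> after
  \<sigma> is \<open>t\<^sub>\<Delta>\<close>. Hence \<sigma>\<cdot>O starts at \<Delta>\<cdot>O on
  the nose.\<close>

lemma wk_Act: "\<sigma> \<in> Hom (cat M) \<Delta> \<Gamma> \<Longrightarrow> Act (Ty M) \<sigma> (wk M O' \<Gamma>) = wk M O' \<Delta>"
  unfolding wk_def
  by (metis Hom_Obj_cod O'_Sec Ty_Comp to_one_Comp to_one_Hom)

lemma wk_one: "wk M O' (one M) = O'"
  by (simp add: wk_def to_one_one Ty_Id one_Obj O'_Sec)

lemma extO_Obj: "\<Gamma> \<in> Obj (cat M) \<Longrightarrow> extO M O' \<Gamma> \<in> Obj (cat M)"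
  unfolding extO_def by (rule ext_Obj[OF _ wk_Sec])

lemma projO_Hom: "\<Gamma> \<in> Obj (cat M) \<Longrightarrow> projO M O' \<Gamma> \<in> Hom (cat M) (extO M O' \<Gamma>) \<Gamma>"
  unfolding extO_def projO_def by (rule proj_Hom[OF _ wk_Sec])

definition varO :: "'o \<Rightarrow> 't"
  where "varO \<Gamma> = var M \<Gamma> (wk M O' \<Gamma>)"

lemma varO_Sec: "\<Gamma> \<in> Obj (cat M) \<Longrightarrow> varO \<Gamma> \<in> Sec (Tm M) (extO M O' \<Gamma>)"
  unfolding varO_def extO_def by (rule var_Sec[OF _ wk_Sec])

lemma tp_varO: "\<Gamma> \<in> Obj (cat M) \<Longrightarrow> tp M (extO M O' \<Gamma>) (varO \<Gamma>) = wk M O' (extO M O' \<Gamma>)"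
  using tp_var[OF _ wk_Sec] wk_Act[OF projO_Hom] unfolding varO_def extO_def projO_def by simp

definition pairO :: "'o \<Rightarrow> 'm \<Rightarrow> 't \<Rightarrow> 'm"
  where "pairO \<Gamma> \<sigma> a = pair M \<Gamma> \<sigma> (wk M O' \<Gamma>) a"

lemma
  assumes "\<sigma> \<in> Hom (cat M) \<Delta> \<Gamma>" "a \<in> Tm_of M \<Delta> (wk M O' \<Delta>)"
  shows pairO_Hom: "pairO \<Gamma> \<sigma> a \<in> Hom (cat M) \<Delta> (extO M O' \<Gamma>)"
    and projO_pairO: "projO M O' \<Gamma> \<odot>\<^bsub>M\<^esub> pairO \<Gamma> \<sigma> a = \<sigma>"
    and varO_pairO: "Act (Tm M) (pairO \<Gamma> \<sigma> a) (varO \<Gamma>) = a"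
proof -
  have G: "\<Gamma> \<in> Obj (cat M)" "wk M O' \<Gamma> \<in> Sec (Ty M) \<Gamma>"
    using Hom_Obj_cod[OF assms(1)] wk_Sec by auto
  have a: "a \<in> Sec (Tm M) \<Delta>" "tp M \<Delta> a = Act (Ty M) \<sigma> (wk M O' \<Gamma>)"
    using assms(2) by (auto simp: Tm_of_def wk_Act[OF assms(1)])
  note pair = pair_Hom[OF G assms(1) a] proj_pair[OF G assms(1) a] var_pair[OF G assms(1) a]
  show "pairO \<Gamma> \<sigma> a \<in> Hom (cat M) \<Delta> (extO M O' \<Gamma>)"
    and "projO M O' \<Gamma> \<odot>\<^bsub>M\<^esub> pairO \<Gamma> \<sigma> a = \<sigma>"
    and "Act (Tm M) (pairO \<Gamma> \<sigma> a) (varO \<Gamma>) = a"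
    unfolding pairO_def extO_def projO_def varO_def by (rule pair)+
qed

lemma extO_eqI:
  assumes "\<Gamma> \<in> Obj (cat M)"
    and "u \<in> Hom (cat M) \<Delta> (extO M O' \<Gamma>)" "v \<in> Hom (cat M) \<Delta> (extO M O' \<Gamma>)"
    and "projO M O' \<Gamma> \<odot>\<^bsub>M\<^esub> u = projO M O' \<Gamma> \<odot>\<^bsub>M\<^esub> v"
    and "Act (Tm M) u (varO \<Gamma>) = Act (Tm M) v (varO \<Gamma>)"
  shows "u = v"
  using ext_eqI[OF assms(1) wk_Sec] assms unfolding extO_def projO_def varO_def by blast

lemma
  assumes s: "\<sigma> \<in> Hom (cat M) \<Delta> \<Gamma>"
  shows liftO_Hom: "liftO M O' \<sigma> \<in> Hom (cat M) (extO M O' \<Delta>) (extO M O' \<Gamma>)"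
    and projO_liftO: "projO M O' \<Gamma> \<odot>\<^bsub>M\<^esub> liftO M O' \<sigma> = \<sigma> \<odot>\<^bsub>M\<^esub> projO M O' \<Delta>"
    and varO_liftO: "Act (Tm M) (liftO M O' \<sigma>) (varO \<Gamma>) = varO \<Delta>"
  using lift_Hom[OF s wk_Sec[OF Hom_Obj_cod[OF s]]] proj_lift[OF s wk_Sec[OF Hom_Obj_cod[OF s]]]
    var_lift[OF s wk_Sec[OF Hom_Obj_cod[OF s]]]
  unfolding liftO_def extO_def projO_def varO_def Hom_Cod[OF s] wk_Act[OF s] by auto

lemma Tm_of_wk_Act:
  assumes "\<sigma> \<in> Hom (cat M) \<Delta> \<Gamma>" "a \<in> Tm_of M \<Gamma> (wk M O' \<Gamma>)"
  shows "Act (Tm M) \<sigma> a \<in> Tm_of M \<Delta> (wk M O' \<Delta>)"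
  using assms by (auto simp: Tm_of_def tp_Act wk_Act intro: Tm_Act)

lemma varO_Tm_of: "\<Gamma> \<in> Obj (cat M) \<Longrightarrow> varO \<Gamma> \<in> Tm_of M (extO M O' \<Gamma>) (wk M O' (extO M O' \<Gamma>))"
  by (simp add: Tm_of_def varO_Sec tp_varO)

section \<open>The swap isomorphism\<close>

context
  fixes \<Gamma> A
  assumes \<Gamma>: "\<Gamma> \<in> Obj (cat M)" and A: "A \<in> Sec (Ty M) \<Gamma>"
begin

private abbreviation (input) "A' \<equiv> Act (Ty M) (projO M O' \<Gamma>) A"
private abbreviation (input) "sw \<equiv> swap M O' \<Gamma> A"

private lemma A'_Sec: "A' \<in> Sec (Ty M) (extO M O' \<Gamma>)"
  by (rule Ty_Act[OF projO_Hom[OF \<Gamma>] A])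

private lemmas pA = proj_Hom[OF \<Gamma> A]
private lemmas pA' = proj_Hom[OF extO_Obj[OF \<Gamma>] A'_Sec]
private lemmas pAO = liftO_Hom[OF pA]
private lemmas pO = projO_Hom[OF \<Gamma>]
private lemmas GA = ext_Obj[OF \<Gamma> A]
private lemmas pO' = projO_Hom[OF GA]

text \<open>The variable of type \<open>O\<close> in \<Gamma>\<cdot>A\<cdot>O is restricted from
  \<Gamma>\<cdot>O along \<open>p\<^sub>A\<cdot>O\<close>, so a map into \<Gamma>\<cdot>A\<cdot>O
  can be tested on that leg and on its projection to \<Gamma>\<cdot>A.\<close>

private lemma varO_ext:
  "w \<in> Hom (cat M) \<Delta> (extO M O' (ext M \<Gamma> A)) \<Longrightarrow>
    Act (Tm M) w (varO (ext M \<Gamma> A)) = Act (Tm M) (liftO M O' (proj M \<Gamma> A) \<odot>\<^bsub>M\<^esub> w) (varO \<Gamma>)"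
  by (simp add: Tm_Comp[OF _ pAO varO_Sec[OF \<Gamma>]] varO_liftO[OF pA])

text \<open>For a weakened type, \<open>\<Gamma>\<cdot>A\<cdot>O\<close> with \<open>p\<^sub>A\<cdot>O\<close> and \<open>q\<^sub>A[p\<^sub>O]\<close> is itself a comprehension of
  \<open>A[p\<^sub>O]\<close>, and \<open>sw\<close> is the comparison with the chosen one.\<close>

lemma extO_ext_universal:
  assumes s: "\<sigma> \<in> Hom (cat M) \<Delta> (extO M O' \<Gamma>)" and a: "a \<in> Sec (Tm M) \<Delta>"
    and tp_a: "tp M \<Delta> a = Act (Ty M) \<sigma> (Act (Ty M) (projO M O' \<Gamma>) A)"
  shows "\<exists>!u. u \<in> Hom (cat M) \<Delta> (extO M O' (ext M \<Gamma> A)) \<and>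
    liftO M O' (proj M \<Gamma> A) \<odot>\<^bsub>M\<^esub> u = \<sigma> \<and>
    Act (Tm M) u (Act (Tm M) (projO M O' (ext M \<Gamma> A)) (var M \<Gamma> A)) = a"
proof (rule ex1I)
  \<comment> \<open>A map into \<Gamma>\<cdot>A\<cdot>O is a map into \<Gamma>\<cdot>A together with
    a term of type \<open>O\<close>. The first is forced by \<sigma> and a, the second is the
    \<open>O\<close>-component of \<sigma>.\<close>
  let ?v = "pair M \<Gamma> (projO M O' \<Gamma> \<odot>\<^bsub>M\<^esub> \<sigma>) A a"
  let ?o = "Act (Tm M) \<sigma> (varO \<Gamma>)"
  let ?u = "pairO (ext M \<Gamma> A) ?v ?o"
  have ps: "projO M O' \<Gamma> \<odot>\<^bsub>M\<^esub> \<sigma> \<in> Hom (cat M) \<Delta> \<Gamma>"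
    by (rule Comp_Hom[OF s pO])
  have tp_a': "tp M \<Delta> a = Act (Ty M) (projO M O' \<Gamma> \<odot>\<^bsub>M\<^esub> \<sigma>) A"
    using tp_a by (simp add: Ty_Comp[OF s pO A])
  note v = pair_Hom[OF \<Gamma> A ps a tp_a'] proj_pair[OF \<Gamma> A ps a tp_a'] var_pair[OF \<Gamma> A ps a tp_a']
  have o: "?o \<in> Tm_of M \<Delta> (wk M O' \<Delta>)"
    by (rule Tm_of_wk_Act[OF s varO_Tm_of[OF \<Gamma>]])
  note u = pairO_Hom[OF v(1) o]
  have "liftO M O' (proj M \<Gamma> A) \<odot>\<^bsub>M\<^esub> ?u = \<sigma>"
  proof (rule extO_eqI[OF \<Gamma> Comp_Hom[OF u pAO] s])
    show "projO M O' \<Gamma> \<odot>\<^bsub>M\<^esub> (liftO M O' (proj M \<Gamma> A) \<odot>\<^bsub>M\<^esub> ?u) = projO M O' \<Gamma> \<odot>\<^bsub>M\<^esub> \<sigma>"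
      unfolding Comp_assoc[OF u pAO pO] projO_liftO[OF pA] Comp_assoc[OF u pO' pA, symmetric]
        projO_pairO[OF v(1) o] v(2) ..
    show "Act (Tm M) (liftO M O' (proj M \<Gamma> A) \<odot>\<^bsub>M\<^esub> ?u) (varO \<Gamma>) = ?o"
      by (simp add: Tm_Comp[OF u pAO varO_Sec[OF \<Gamma>]] varO_liftO[OF pA] varO_pairO[OF v(1) o])
  qed
  moreover have "Act (Tm M) ?u (Act (Tm M) (projO M O' (ext M \<Gamma> A)) (var M \<Gamma> A)) = a"
    by (simp add: Tm_Comp[OF u pO' var_Sec[OF \<Gamma> A], symmetric] projO_pairO[OF v(1) o] v(3))
  ultimately show "?u \<in> Hom (cat M) \<Delta> (extO M O' (ext M \<Gamma> A)) \<and>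
      liftO M O' (proj M \<Gamma> A) \<odot>\<^bsub>M\<^esub> ?u = \<sigma> \<and>
      Act (Tm M) ?u (Act (Tm M) (projO M O' (ext M \<Gamma> A)) (var M \<Gamma> A)) = a"
    using u by blast
  fix w
  assume "w \<in> Hom (cat M) \<Delta> (extO M O' (ext M \<Gamma> A)) \<and>
    liftO M O' (proj M \<Gamma> A) \<odot>\<^bsub>M\<^esub> w = \<sigma> \<and>
    Act (Tm M) w (Act (Tm M) (projO M O' (ext M \<Gamma> A)) (var M \<Gamma> A)) = a"
  then have w: "w \<in> Hom (cat M) \<Delta> (extO M O' (ext M \<Gamma> A))"
    and w1: "liftO M O' (proj M \<Gamma> A) \<odot>\<^bsub>M\<^esub> w = \<sigma>"
    and w2: "Act (Tm M) w (Act (Tm M) (projO M O' (ext M \<Gamma> A)) (var M \<Gamma> A)) = a"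
    by auto
  show "w = ?u"
  proof (rule extO_eqI[OF GA w u])
    have "projO M O' (ext M \<Gamma> A) \<odot>\<^bsub>M\<^esub> w = ?v"
    proof (rule ext_eqI[OF \<Gamma> A Comp_Hom[OF w pO'] v(1)])
      show "proj M \<Gamma> A \<odot>\<^bsub>M\<^esub> (projO M O' (ext M \<Gamma> A) \<odot>\<^bsub>M\<^esub> w) = proj M \<Gamma> A \<odot>\<^bsub>M\<^esub> ?v"
        unfolding Comp_assoc[OF w pO' pA] projO_liftO[OF pA, symmetric]
          Comp_assoc[OF w pAO pO, symmetric] w1 v(2) ..
      show "Act (Tm M) (projO M O' (ext M \<Gamma> A) \<odot>\<^bsub>M\<^esub> w) (var M \<Gamma> A) = Act (Tm M) ?v (var M \<Gamma> A)"
        by (simp add: Tm_Comp[OF w pO' var_Sec[OF \<Gamma> A]] w2 v(3))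
    qed
    then show "projO M O' (ext M \<Gamma> A) \<odot>\<^bsub>M\<^esub> w = projO M O' (ext M \<Gamma> A) \<odot>\<^bsub>M\<^esub> ?u"
      by (simp add: projO_pairO[OF v(1) o])
    show "Act (Tm M) w (varO (ext M \<Gamma> A)) = Act (Tm M) ?u (varO (ext M \<Gamma> A))"
      by (simp add: varO_ext[OF w] w1 varO_pairO[OF v(1) o])
  qed
qed

text \<open>Since \<open>swap\<close> is a definite description, unique existence has to be shown.
  The witness \<open>?s\<close> pairs \<open>p\<^sub>O\<cdot>A\<close> with the weakened variable of
  \<Gamma>\<cdot>O; for uniqueness, the second defining equation fixes the
  \<open>O\<close>-component.\<close>

lemma
  shows swap_Hom: "swap M O' \<Gamma> A \<in> Hom (cat M)
      (ext M (extO M O' \<Gamma>) (Act (Ty M) (projO M O' \<Gamma>) A)) (extO M O' (ext M \<Gamma> A))"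
    and projO_swap: "projO M O' (ext M \<Gamma> A) \<odot>\<^bsub>M\<^esub> swap M O' \<Gamma> A = lift M (projO M O' \<Gamma>) A"
    and liftO_swap: "liftO M O' (proj M \<Gamma> A) \<odot>\<^bsub>M\<^esub> swap M O' \<Gamma> A =
      proj M (extO M O' \<Gamma>) (Act (Ty M) (projO M O' \<Gamma>) A)"
proof -
  let ?l = "lift M (projO M O' \<Gamma>) A" and ?p = "proj M (extO M O' \<Gamma>) A'"
  let ?o = "Act (Tm M) ?p (varO \<Gamma>)"
  let ?s = "pairO (ext M \<Gamma> A) ?l ?o"
  note l = lift_Hom[OF pO A]
  have o: "?o \<in> Tm_of M (ext M (extO M O' \<Gamma>) A') (wk M O' (ext M (extO M O' \<Gamma>) A'))"
    by (rule Tm_of_wk_Act[OF pA' varO_Tm_of[OF \<Gamma>]])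
  note s = pairO_Hom[OF l o]
  have "\<exists>!s. s \<in> Hom (cat M) (ext M (extO M O' \<Gamma>) A') (extO M O' (ext M \<Gamma> A)) \<and>
      projO M O' (ext M \<Gamma> A) \<odot>\<^bsub>M\<^esub> s = ?l \<and> liftO M O' (proj M \<Gamma> A) \<odot>\<^bsub>M\<^esub> s = ?p"
  proof (rule ex1I)
    have "liftO M O' (proj M \<Gamma> A) \<odot>\<^bsub>M\<^esub> ?s = ?p"
    proof (rule extO_eqI[OF \<Gamma> Comp_Hom[OF s pAO] pA'])
      show "projO M O' \<Gamma> \<odot>\<^bsub>M\<^esub> (liftO M O' (proj M \<Gamma> A) \<odot>\<^bsub>M\<^esub> ?s) = projO M O' \<Gamma> \<odot>\<^bsub>M\<^esub> ?p"
        unfolding Comp_assoc[OF s pAO pO] projO_liftO[OF pA] Comp_assoc[OF s pO' pA, symmetric]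
          projO_pairO[OF l o] proj_lift[OF pO A] ..
      show "Act (Tm M) (liftO M O' (proj M \<Gamma> A) \<odot>\<^bsub>M\<^esub> ?s) (varO \<Gamma>) = ?o"
        by (simp add: Tm_Comp[OF s pAO varO_Sec[OF \<Gamma>]] varO_liftO[OF pA] varO_pairO[OF l o])
    qed
    then show "?s \<in> Hom (cat M) (ext M (extO M O' \<Gamma>) A') (extO M O' (ext M \<Gamma> A)) \<and>
        projO M O' (ext M \<Gamma> A) \<odot>\<^bsub>M\<^esub> ?s = ?l \<and> liftO M O' (proj M \<Gamma> A) \<odot>\<^bsub>M\<^esub> ?s = ?p"
      using s projO_pairO[OF l o] by blast
    fix w
    assume "w \<in> Hom (cat M) (ext M (extO M O' \<Gamma>) A') (extO M O' (ext M \<Gamma> A)) \<and>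
      projO M O' (ext M \<Gamma> A) \<odot>\<^bsub>M\<^esub> w = ?l \<and> liftO M O' (proj M \<Gamma> A) \<odot>\<^bsub>M\<^esub> w = ?p"
    then have w: "w \<in> Hom (cat M) (ext M (extO M O' \<Gamma>) A') (extO M O' (ext M \<Gamma> A))"
      and w1: "projO M O' (ext M \<Gamma> A) \<odot>\<^bsub>M\<^esub> w = ?l"
      and w2: "liftO M O' (proj M \<Gamma> A) \<odot>\<^bsub>M\<^esub> w = ?p"
      by auto
    show "w = ?s"
      by (rule extO_eqI[OF GA w s])
        (simp_all add: w1 projO_pairO[OF l o] varO_ext[OF w] w2 varO_pairO[OF l o])
  qed
  from theI'[OF this]
  show "sw \<in> Hom (cat M) (ext M (extO M O' \<Gamma>) A') (extO M O' (ext M \<Gamma> A))"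
    and "projO M O' (ext M \<Gamma> A) \<odot>\<^bsub>M\<^esub> sw = ?l" and "liftO M O' (proj M \<Gamma> A) \<odot>\<^bsub>M\<^esub> sw = ?p"
    unfolding swap_def Let_def by auto
qed

text \<open>The inverse is \<open>?t\<close>, the comparison in the other direction:
  \<open>p\<^sub>A\<cdot>O\<close> and \<open>q\<^sub>A[p\<^sub>O]\<close> paired into the chosen
  comprehension. Each composite is the identity by uniqueness for the comprehension at which it
  ends.\<close>

lemma
  shows inverse_swap_Hom: "inverse_arr (cat M) (swap M O' \<Gamma> A) \<in> Hom (cat M)
      (extO M O' (ext M \<Gamma> A)) (ext M (extO M O' \<Gamma>) (Act (Ty M) (projO M O' \<Gamma>) A))"
    and swap_inverse: "swap M O' \<Gamma> A \<odot>\<^bsub>M\<^esub> inverse_arr (cat M) (swap M O' \<Gamma> A) =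
      Id (cat M) (extO M O' (ext M \<Gamma> A))"
proof -
  note s = swap_Hom
  let ?E = "extO M O' (ext M \<Gamma> A)" and ?E' = "ext M (extO M O' \<Gamma>) A'"
  let ?p = "liftO M O' (proj M \<Gamma> A)" and ?q = "Act (Tm M) (projO M O' (ext M \<Gamma> A)) (var M \<Gamma> A)"
  let ?t = "pair M (extO M O' \<Gamma>) ?p A' ?q"
  have q: "?q \<in> Sec (Tm M) ?E" by (rule Tm_Act[OF pO' var_Sec[OF \<Gamma> A]])
  have tq: "tp M ?E ?q = Act (Ty M) ?p A'"
    by (simp add: tp_Act[OF pO' var_Sec[OF \<Gamma> A]] tp_var[OF \<Gamma> A] Ty_Comp[OF pO' pA A, symmetric]
        Ty_Comp[OF pAO pO A, symmetric] projO_liftO[OF pA])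
  note t = pair_Hom[OF extO_Obj[OF \<Gamma>] A'_Sec pAO q tq] proj_pair[OF extO_Obj[OF \<Gamma>] A'_Sec pAO q tq]
    var_pair[OF extO_Obj[OF \<Gamma>] A'_Sec pAO q tq]
  have qs: "Act (Tm M) sw ?q = var M (extO M O' \<Gamma>) A'"
    by (simp add: Tm_Comp[OF s pO' var_Sec[OF \<Gamma> A], symmetric] projO_swap var_lift[OF pO A])
  have 1: "?t \<odot>\<^bsub>M\<^esub> sw = Id (cat M) ?E'"
  proof (rule ext_eqI[OF extO_Obj[OF \<Gamma>] A'_Sec Comp_Hom[OF s t(1)] Id_Hom[OF Hom_Obj_dom[OF s]]])
    show "proj M (extO M O' \<Gamma>) A' \<odot>\<^bsub>M\<^esub> (?t \<odot>\<^bsub>M\<^esub> sw) = proj M (extO M O' \<Gamma>) A' \<odot>\<^bsub>M\<^esub> Id (cat M) ?E'"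
      unfolding Comp_assoc[OF s t(1) pA'] t(2) liftO_swap Comp_Id_right[OF pA'] ..
    show "Act (Tm M) (?t \<odot>\<^bsub>M\<^esub> sw) (var M (extO M O' \<Gamma>) A') =
        Act (Tm M) (Id (cat M) ?E') (var M (extO M O' \<Gamma>) A')"
      using var_Sec[OF extO_Obj[OF \<Gamma>] A'_Sec]
      by (simp add: Tm_Comp[OF s t(1)] t(3) qs Tm_Id Hom_Obj_dom[OF s])
  qed
  have 2: "sw \<odot>\<^bsub>M\<^esub> ?t = Id (cat M) ?E"
  proof -
    note E = Hom_Obj_cod[OF s]
    have st: "sw \<odot>\<^bsub>M\<^esub> ?t \<in> Hom (cat M) ?E ?E" by (rule Comp_Hom[OF t(1) s])
    have "?p \<odot>\<^bsub>M\<^esub> (sw \<odot>\<^bsub>M\<^esub> ?t) = ?p"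
      unfolding Comp_assoc[OF t(1) s pAO] liftO_swap t(2) ..
    moreover have "Act (Tm M) (sw \<odot>\<^bsub>M\<^esub> ?t) ?q = ?q"
      by (simp add: Tm_Comp[OF t(1) s q] qs t(3))
    moreover have "?p \<odot>\<^bsub>M\<^esub> Id (cat M) ?E = ?p" "Act (Tm M) (Id (cat M) ?E) ?q = ?q"
      by (auto simp: Comp_Id_right[OF pAO] Tm_Id[OF E q])
    ultimately show ?thesis
      using extO_ext_universal[OF pAO q tq] st Id_Hom[OF E] by blast
  qed
  have "inverse_arr (cat M) sw = ?t"
    unfolding inverse_arr_def Hom_Dom[OF s] Hom_Cod[OF s]
  proof (rule the_equality)
    show "?t \<in> Hom (cat M) ?E ?E' \<and> ?t \<odot>\<^bsub>M\<^esub> sw = Id (cat M) ?E' \<and> sw \<odot>\<^bsub>M\<^esub> ?t = Id (cat M) ?E"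
      using t 1 2 by blast
    fix g
    assume g: "g \<in> Hom (cat M) ?E ?E' \<and> g \<odot>\<^bsub>M\<^esub> sw = Id (cat M) ?E' \<and> sw \<odot>\<^bsub>M\<^esub> g = Id (cat M) ?E"
    then have "g \<odot>\<^bsub>M\<^esub> (sw \<odot>\<^bsub>M\<^esub> ?t) = Id (cat M) ?E' \<odot>\<^bsub>M\<^esub> ?t"
      by (simp add: Comp_assoc[OF t(1) s conjunct1[OF g]])
    then show "g = ?t"
      by (simp add: 2 Comp_Id_left[OF t(1)] Comp_Id_right[OF conjunct1[OF g]])
  qed
  then show "inverse_arr (cat M) sw \<in> Hom (cat M) ?E ?E'"
    and "sw \<odot>\<^bsub>M\<^esub> inverse_arr (cat M) sw = Id (cat M) ?E"
    using t(1) 2 by auto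
qed

text \<open>Together with \<open>var_inverse_swap\<close> this eliminates \<open>sw\<close> from the
  weakened case: the projection and variable expressed through its inverse are just the images of
  \<open>p\<^sub>A\<close> and \<open>q\<^sub>A\<close> under the inclusion.\<close>

lemma proj_inverse_swap:
  "proj M (extO M O' \<Gamma>) (Act (Ty M) (projO M O' \<Gamma>) A) \<odot>\<^bsub>M\<^esub>
      inverse_arr (cat M) (swap M O' \<Gamma> A) = liftO M O' (proj M \<Gamma> A)"
  unfolding liftO_swap[symmetric] Comp_assoc[OF inverse_swap_Hom swap_Hom pAO, symmetric]
    swap_inverse Comp_Id_right[OF pAO] ..

lemma var_inverse_swap:
  "Act (Tm M) (inverse_arr (cat M) (swap M O' \<Gamma> A))
      (var M (extO M O' \<Gamma>) (Act (Ty M) (projO M O' \<Gamma>) A)) =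
    Act (Tm M) (projO M O' (ext M \<Gamma> A)) (var M \<Gamma> A)"
  by (simp add: var_lift[OF pO A, symmetric] projO_swap[symmetric]
      Tm_Comp[OF swap_Hom pO' var_Sec[OF \<Gamma> A]]
      Tm_Comp[OF inverse_swap_Hom swap_Hom Tm_Act[OF pO' var_Sec[OF \<Gamma> A]], symmetric]
      swap_inverse Tm_Id[OF Hom_Obj_cod[OF swap_Hom] Tm_Act[OF pO' var_Sec[OF \<Gamma> A]]])

end

end

lemma (in small_category) is_natural_element_map:
  "\<lbrakk>is_presheaf C P; X \<in> Obj C; x \<in> Sec P X\<rbrakk> \<Longrightarrow> is_natural C (yoneda C X) P (element_map P x)"
  unfolding is_natural_def is_presheaf_def yoneda_def element_map_def by auto

text \<open>Naturality of the Yoneda maps is automatic, and commutativity follows from its instance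
  \<open>tq\<close> at the universal element. What remains to check for a comprehension square is
  the lifting of single maps.\<close>

lemma (in small_category) is_pullback_comprehension:
  assumes P: "is_presheaf C P" and Q: "is_presheaf C Q" and t: "is_natural C P Q t"
    and p: "p \<in> Hom C E \<Gamma>" and q: "q \<in> Sec P E" and A: "A \<in> Sec Q \<Gamma>"
    and tq: "t E q = Act Q p A"
    and universal: "\<And>\<Delta> \<sigma> a. \<lbrakk>\<sigma> \<in> Hom C \<Delta> \<Gamma>; a \<in> Sec P \<Delta>; t \<Delta> a = Act Q \<sigma> A\<rbrakk> \<Longrightarrow>
      \<exists>!u. u \<in> Hom C \<Delta> E \<and> Comp C p u = \<sigma> \<and> Act P u q = a"
  shows "is_pullback C (yoneda C E) P (yoneda C \<Gamma>) Q
    (element_map P q) (yoneda_map C p) t (element_map Q A)"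
proof -
  note E = Hom_Obj_dom[OF p] and G = Hom_Obj_cod[OF p]
  have "is_natural C (yoneda C E) (yoneda C \<Gamma>) (yoneda_map C p)"
    using p by (auto simp: is_natural_def yoneda_def yoneda_map_def Comp_Hom Comp_assoc)
  moreover have "t \<Delta> (Act P u q) = Act Q (Comp C p u) A" if "u \<in> Hom C \<Delta> E" for \<Delta> u
  proof -
    have "t \<Delta> (Act P u q) = Act Q u (t E q)"
      using t that q Hom_Obj[OF that] unfolding is_natural_def by blast
    also have "\<dots> = Act Q (Comp C p u) A"
      using Q that p A Hom_Obj[OF that] G unfolding is_presheaf_def tq by metis
    finally show ?thesis .
  qed
  ultimately show ?thesis
    unfolding is_pullback_def using is_natural_element_map[OF P E q] is_natural_element_map[OF Q G A] t universal
    by (auto simp: yoneda_def element_map_def yoneda_map_def conj_commute)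
qed

lemma free_model_simps [simp]:
  "cat (free_model M O') = free_cat M O'"
  "one (free_model M O') = (one M, [])"
  "Sec (Ty (free_model M O')) X = Sec (Ty M) (total M O' X)"
  "Sec (Tm (free_model M O')) X = Sec (Tm M) (total M O' X)"
  "Act (Ty (free_model M O')) (X, f, Y) = Act (Ty M) f"
  "Act (Tm (free_model M O')) (X, f, Y) = Act (Tm M) f"
  "tp (free_model M O') = (\<lambda>X. tp M (total M O' X))"
  "ext (free_model M O') = free_ext M O'"
  "proj (free_model M O') = free_proj M O'"
  "var (free_model M O') = free_var M O'"
  by (simp_all add: free_model_def precomp_def)

lemma total_Nil: "total M O' (\<Gamma>, []) = extO M O' \<Gamma>"
  by (simp add: total_def)

section \<open>Objects and arrows of the free category\<close>

context term_extension
begin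

text \<open>Well-typed lists, normal or not. Totals, \<open>gen\<close> and the sections below make
  sense at this level; normal forms enter with \<open>free_ext\<close>.\<close>

definition raw_Obj :: "('o \<times> 'u list) set"
  where "raw_Obj = {(\<Gamma>, As). \<Gamma> \<in> Obj (cat M) \<and> is_telescope M (extO M O' \<Gamma>) As}"

text \<open>The value of the adjoined term x over X: the variable of type \<open>O\<close>, weakened
  along the rest of the telescope.\<close>

definition gen :: "'o \<times> 'u list \<Rightarrow> 't"
  where "gen X = Act (Tm M) (proj_list M (extO M O' (fst X)) (snd X)) (varO (fst X))"

lemma free_raw: "X \<in> free_Obj M O' \<Longrightarrow> X \<in> raw_Obj"
  by (auto simp: free_Obj_def raw_Obj_def)

lemma total_Obj: "X \<in> raw_Obj \<Longrightarrow> total M O' X \<in> Obj (cat M)"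
  by (auto simp: raw_Obj_def total_def extO_Obj ext_list_Obj)

lemma gen_Tm_of: "X \<in> raw_Obj \<Longrightarrow> gen X \<in> Tm_of M (total M O' X) (wk M O' (total M O' X))"
  by (auto simp: raw_Obj_def total_def gen_def extO_Obj
      intro!: Tm_of_wk_Act[OF proj_list_Hom varO_Tm_of])

lemma gen_Sec: "X \<in> raw_Obj \<Longrightarrow> gen X \<in> Sec (Tm M) (total M O' X)"
  using gen_Tm_of by (simp add: Tm_of_def)

lemma total_snoc: "total M O' (\<Gamma>, As @ [A]) = ext M (total M O' (\<Gamma>, As)) A"
  by (simp add: total_def ext_list_snoc)

lemma raw_snoc: "(\<Gamma>, As @ [A]) \<in> raw_Obj \<longleftrightarrow>
    (\<Gamma>, As) \<in> raw_Obj \<and> A \<in> Sec (Ty M) (total M O' (\<Gamma>, As))"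
  by (auto simp: raw_Obj_def total_def is_telescope_snoc)

lemma gen_Nil: "\<Gamma> \<in> Obj (cat M) \<Longrightarrow> gen (\<Gamma>, []) = varO \<Gamma>"
  by (simp add: gen_def Tm_Id extO_Obj varO_Sec)

lemma gen_snoc:
  assumes "(\<Gamma>, As @ [A]) \<in> raw_Obj"
  shows "gen (\<Gamma>, As @ [A]) = Act (Tm M) (proj M (total M O' (\<Gamma>, As)) A) (gen (\<Gamma>, As))"
proof -
  have G: "\<Gamma> \<in> Obj (cat M)" and t: "is_telescope M (extO M O' \<Gamma>) (As @ [A])"
    and t': "is_telescope M (extO M O' \<Gamma>) As" "A \<in> Sec (Ty M) (ext_list M (extO M O' \<Gamma>) As)"
    using assms by (auto simp: raw_Obj_def is_telescope_snoc)
  note E = extO_Obj[OF G]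
  show ?thesis
    by (simp add: gen_def total_def proj_list_snoc[OF E t] varO_Sec[OF G]
        Tm_Comp[OF proj_Hom[OF ext_list_Obj[OF E t'(1)] t'(2)] proj_list_Hom[OF E t'(1)]])
qed

lemma
  assumes "X \<in> raw_Obj"
  shows canonical_Hom: "canonical M O' X \<in> Hom (cat M) (total M O' X) (ext M (one M) O')"
    and var_canonical: "Act (Tm M) (canonical M O' X) (var M (one M) O') = gen X"
proof -
  have G: "fst X \<in> Obj (cat M)" and t: "is_telescope M (extO M O' (fst X)) (snd X)"
    using assms by (auto simp: raw_Obj_def)
  note l = lift_Hom[OF to_one_Hom[OF G] O'_Sec, folded wk_def, folded extO_def]
  note p = proj_list_Hom[OF extO_Obj[OF G] t]
  show "canonical M O' X \<in> Hom (cat M) (total M O' X) (ext M (one M) O')"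
    unfolding canonical_def total_def by (rule Comp_Hom[OF p l])
  show "Act (Tm M) (canonical M O' X) (var M (one M) O') = gen X"
    unfolding canonical_def gen_def Tm_Comp[OF p l var_Sec[OF one_Obj O'_Sec]]
      var_lift[OF to_one_Hom[OF G] O'_Sec] varO_def wk_def ..
qed

text \<open>Maps into \<open>\<diamond>\<cdot>O\<close> are terms of type \<open>O\<close>, so commuting with the canonical maps means
  preserving \<open>gen\<close>.\<close>

lemma canonical_Comp_iff:
  assumes "X \<in> raw_Obj" "Y \<in> raw_Obj" and f: "f \<in> Hom (cat M) (total M O' X) (total M O' Y)"
  shows "canonical M O' Y \<odot>\<^bsub>M\<^esub> f = canonical M O' X \<longleftrightarrow> Act (Tm M) f (gen Y) = gen X"
proof
  note c = canonical_Hom[OF assms(2)] and q = var_Sec[OF one_Obj O'_Sec]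
  have "Act (Tm M) (canonical M O' Y \<odot>\<^bsub>M\<^esub> f) (var M (one M) O') = Act (Tm M) f (gen Y)"
    by (simp add: Tm_Comp[OF f c q] var_canonical assms)
  then show "canonical M O' Y \<odot>\<^bsub>M\<^esub> f = canonical M O' X \<Longrightarrow> Act (Tm M) f (gen Y) = gen X"
    and "Act (Tm M) f (gen Y) = gen X \<Longrightarrow> canonical M O' Y \<odot>\<^bsub>M\<^esub> f = canonical M O' X"
    using ext_eqI[OF one_Obj O'_Sec Comp_Hom[OF f c] canonical_Hom[OF assms(1)]] var_canonical[OF assms(1)]
      to_one_unique[OF Comp_Hom[OF Comp_Hom[OF f c] proj_Hom[OF one_Obj O'_Sec]]]
      to_one_unique[OF Comp_Hom[OF canonical_Hom[OF assms(1)] proj_Hom[OF one_Obj O'_Sec]]] by auto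
qed

text \<open>The condition over \<diamond>\<cdot>O in the form given by
  \<open>canonical_Comp_iff\<close>: an equation of terms, which composes by functoriality of
  restriction.\<close>

definition is_free_arr :: "'o \<times> 'u list \<Rightarrow> 'm \<Rightarrow> 'o \<times> 'u list \<Rightarrow> bool"
  where "is_free_arr X f Y \<longleftrightarrow> X \<in> free_Obj M O' \<and> Y \<in> free_Obj M O' \<and>
    f \<in> Hom (cat M) (total M O' X) (total M O' Y) \<and> Act (Tm M) f (gen Y) = gen X"

lemma Obj_free_cat [simp]: "Obj (free_cat M O') = free_Obj M O'"
  and Id_free_cat [simp]: "Id (free_cat M O') X = (X, Id (cat M) (total M O' X), X)"
  and Comp_free_cat [simp]: "Comp (free_cat M O') (Y', g, Z) (X, f, Y) = (X, g \<odot>\<^bsub>M\<^esub> f, Z)"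
  by (simp_all add: free_cat_def)

lemma Arr_free_cat: "\<phi> \<in> Arr (free_cat M O') \<longleftrightarrow> (\<exists>X f Y. \<phi> = (X, f, Y) \<and> is_free_arr X f Y)"
  by (auto simp: free_cat_def is_free_arr_def canonical_Comp_iff free_raw)

lemma Hom_free_cat: "\<phi> \<in> Hom (free_cat M O') X Y \<longleftrightarrow> (\<exists>f. \<phi> = (X, f, Y) \<and> is_free_arr X f Y)"
  unfolding Hom_def[of "free_cat M O'"] mem_Collect_eq Arr_free_cat
  by (cases X, cases Y) (auto simp: free_cat_def)

lemma Hom_free_catI: "is_free_arr X f Y \<Longrightarrow> (X, f, Y) \<in> Hom (free_cat M O') X Y"
  by (simp add: Hom_free_cat)

lemma is_free_arr_Hom: "is_free_arr X f Y \<Longrightarrow> f \<in> Hom (cat M) (total M O' X) (total M O' Y)"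
  by (simp add: is_free_arr_def)

lemma is_free_arr_Id: "X \<in> free_Obj M O' \<Longrightarrow> is_free_arr X (Id (cat M) (total M O' X)) X"
  by (simp add: is_free_arr_def Id_Hom Tm_Id total_Obj gen_Sec free_raw)

lemma is_free_arr_Comp: "is_free_arr X f Y \<Longrightarrow> is_free_arr Y g Z \<Longrightarrow> is_free_arr X (g \<odot>\<^bsub>M\<^esub> f) Z"
  by (auto simp: is_free_arr_def Tm_Comp gen_Sec free_raw intro: Comp_Hom)

lemma small_category_free_cat: "small_category (free_cat M O')"
proof
  show "f \<in> Arr (free_cat M O') \<Longrightarrow> Dom (free_cat M O') f \<in> Obj (free_cat M O')"
    and "f \<in> Arr (free_cat M O') \<Longrightarrow> Cod (free_cat M O') f \<in> Obj (free_cat M O')" for f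
    by (auto simp: free_cat_def)
qed (auto simp: Hom_free_cat is_free_arr_Id is_free_arr_Comp Comp_Id_left[OF is_free_arr_Hom]
    Comp_Id_right[OF is_free_arr_Hom] Comp_assoc[OF is_free_arr_Hom is_free_arr_Hom is_free_arr_Hom])

lemma is_presheaf_free_Ty: "is_presheaf (free_cat M O') (Ty (free_model M O'))"
  by (auto simp: is_presheaf_def Hom_free_cat Ty_Act[OF is_free_arr_Hom] Ty_Id total_Obj free_raw
      Ty_Comp[OF is_free_arr_Hom is_free_arr_Hom])

lemma is_presheaf_free_Tm: "is_presheaf (free_cat M O') (Tm (free_model M O'))"
  by (auto simp: is_presheaf_def Hom_free_cat Tm_Act[OF is_free_arr_Hom] Tm_Id total_Obj free_raw
      Tm_Comp[OF is_free_arr_Hom is_free_arr_Hom])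

lemma is_natural_free_tp:
  "is_natural (free_cat M O') (Tm (free_model M O')) (Ty (free_model M O')) (tp (free_model M O'))"
  by (auto simp: is_natural_def Hom_free_cat tp_Sec total_Obj free_raw tp_Act[OF is_free_arr_Hom])

lemma Nil_free_Obj: "(\<Gamma>, []) \<in> free_Obj M O' \<longleftrightarrow> \<Gamma> \<in> Obj (cat M)"
  by (simp add: free_Obj_def)

text \<open>The total of (\<diamond>) is \<diamond>\<cdot>O with \<open>gen\<close> its variable, so
  the condition on an arrow into it forces the canonical morphism.\<close>

lemma is_terminal_free_cat: "is_terminal (free_cat M O') (one M, [])"
  unfolding is_terminal_def
proof (intro conjI ballI)
  show "(one M, []) \<in> Obj (free_cat M O')"
    by (simp add: Nil_free_Obj one_Obj)
  fix X assume "X \<in> Obj (free_cat M O')"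
  then have X: "X \<in> free_Obj M O'" by simp
  note c = canonical_Hom[OF free_raw[OF X]]
  have eO: "extO M O' (one M) = ext M (one M) O'" and vO: "varO (one M) = var M (one M) O'"
    by (simp_all add: extO_def varO_def wk_one)
  have g: "gen (one M, []) = var M (one M) O'"
    by (simp add: gen_Nil one_Obj vO)
  have iff: "is_free_arr X f (one M, []) \<longleftrightarrow> f = canonical M O' X" for f
  proof
    assume "is_free_arr X f (one M, [])"
    then have f: "f \<in> Hom (cat M) (total M O' X) (ext M (one M) O')"
      and "Act (Tm M) f (var M (one M) O') = gen X"
      by (auto simp: is_free_arr_def total_Nil eO g)
    then show "f = canonical M O' X"
      using ext_eqI[OF one_Obj O'_Sec f c] var_canonical[OF free_raw[OF X]]
        to_one_unique[OF Comp_Hom[OF f proj_Hom[OF one_Obj O'_Sec]]]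
        to_one_unique[OF Comp_Hom[OF c proj_Hom[OF one_Obj O'_Sec]]] by auto
  next
    assume "f = canonical M O' X"
    then show "is_free_arr X f (one M, [])"
      using X c by (simp add: is_free_arr_def Nil_free_Obj one_Obj total_Nil eO g var_canonical free_raw)
  qed
  show "\<exists>!f. f \<in> Hom (free_cat M O') X (one M, [])"
    by (auto simp: Hom_free_cat iff)
qed

section \<open>Context extension in the free model\<close>

lemma is_weakened_strengthen:
  assumes "is_weakened M O' \<Gamma> B"
  shows "strengthen M O' \<Gamma> B \<in> Sec (Ty M) \<Gamma>"
    and "Act (Ty M) (projO M O' \<Gamma>) (strengthen M O' \<Gamma> B) = B"
  using someI_ex[of "\<lambda>A. A \<in> Sec (Ty M) \<Gamma> \<and> Act (Ty M) (projO M O' \<Gamma>) A = B"] assms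
  unfolding is_weakened_def strengthen_def by blast+

text \<open>Whatever A \<open>strengthen\<close> picks, in the weakened case the extension data are
  the images under \<open>inclusion\<close> of those of A over \<Gamma>. This form of the case
  distinction hides both \<open>strengthen\<close> and \<open>swap\<close>.\<close>

lemma free_ext_cases:
  assumes X: "X \<in> free_Obj M O'" and B: "B \<in> Sec (Ty M) (total M O' X)"
  obtains
    (weakened) \<Gamma> A where "X = (\<Gamma>, [])" "\<Gamma> \<in> Obj (cat M)" "A \<in> Sec (Ty M) \<Gamma>"
      "B = Act (Ty M) (projO M O' \<Gamma>) A" "free_ext M O' X B = (ext M \<Gamma> A, [])"
      "free_proj M O' X B = ((ext M \<Gamma> A, []), liftO M O' (proj M \<Gamma> A), (\<Gamma>, []))"
      "free_var M O' X B = Act (Tm M) (projO M O' (ext M \<Gamma> A)) (var M \<Gamma> A)"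
  | (normal) \<Gamma> As where "X = (\<Gamma>, As)" "(\<Gamma>, As @ [B]) \<in> free_Obj M O'"
      "free_ext M O' X B = (\<Gamma>, As @ [B])"
      "free_proj M O' X B = ((\<Gamma>, As @ [B]), proj M (total M O' X) B, (\<Gamma>, As))"
      "free_var M O' X B = var M (total M O' X) B"
proof -
  obtain \<Gamma> As where XE: "X = (\<Gamma>, As)" by fastforce
  show thesis
  proof (cases "As = [] \<and> is_weakened M O' \<Gamma> B")
    case True
    have G: "\<Gamma> \<in> Obj (cat M)" using X XE by (auto simp: free_Obj_def)
    note A = is_weakened_strengthen[OF conjunct2[OF True]]
    show thesis
      using weakened[OF _ G A(1)] True XE A(2) proj_inverse_swap[OF G A(1)] var_inverse_swap[OF G A(1)]
      by (simp add: free_ext_def free_proj_def free_var_def)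
  next
    case False
    \<comment> \<open>Normality concerns the head alone: it is B when \<open>As\<close> is empty,
      and then the case excludes that B is weakened; otherwise it is the head of
      \<open>As\<close>.\<close>
    have "(\<Gamma>, As @ [B]) \<in> free_Obj M O'"
      using X B False XE by (cases As) (auto simp: free_Obj_def total_def is_telescope_snoc)
    then show thesis
      using normal[OF XE] False XE by (auto simp: free_ext_def free_proj_def free_var_def)
  qed
qed

text \<open>The universal property is tested against arbitrary contexts \<Delta> of \<open>M\<close>
  and arbitrary maps into the total of X. The condition on \<open>gen\<close> can be added
  afterwards, because p preserves it.\<close>

lemma free_comprehension:
  assumes X: "X \<in> free_Obj M O'" and B: "B \<in> Sec (Ty M) (total M O' X)"
  obtains p where "free_proj M O' X B = (free_ext M O' X B, p, X)"
    "is_free_arr (free_ext M O' X B) p X"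
    "free_var M O' X B \<in> Sec (Tm M) (total M O' (free_ext M O' X B))"
    "tp M (total M O' (free_ext M O' X B)) (free_var M O' X B) = Act (Ty M) p B"
    "\<And>\<Delta> \<sigma> a. \<lbrakk>\<sigma> \<in> Hom (cat M) \<Delta> (total M O' X); a \<in> Sec (Tm M) \<Delta>; tp M \<Delta> a = Act (Ty M) \<sigma> B\<rbrakk> \<Longrightarrow>
      \<exists>!u. u \<in> Hom (cat M) \<Delta> (total M O' (free_ext M O' X B)) \<and> p \<odot>\<^bsub>M\<^esub> u = \<sigma> \<and>
        Act (Tm M) u (free_var M O' X B) = a"
  using X B
proof (cases rule: free_ext_cases)
  case (weakened \<Gamma> A)
  note GA = weakened(2,3)
  note E = ext_Obj[OF GA] and p = proj_Hom[OF GA] and q = var_Sec[OF GA]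
  note pO = projO_Hom[OF E]
  show thesis
  proof (rule that)
    show "free_proj M O' X B = (free_ext M O' X B, liftO M O' (proj M \<Gamma> A), X)"
      using weakened by simp
    show "is_free_arr (free_ext M O' X B) (liftO M O' (proj M \<Gamma> A)) X"
      unfolding weakened(5)
      by (simp add: is_free_arr_def weakened(1) GA(1) Nil_free_Obj E total_Nil liftO_Hom[OF p] gen_Nil varO_liftO[OF p])
    show "free_var M O' X B \<in> Sec (Tm M) (total M O' (free_ext M O' X B))"
      unfolding weakened(5,7)
      by (simp add: total_Nil Tm_Act[OF pO q])
    show "tp M (total M O' (free_ext M O' X B)) (free_var M O' X B) =
        Act (Ty M) (liftO M O' (proj M \<Gamma> A)) B"
      unfolding weakened(5,7)
      by (simp add: weakened(4) total_Nil tp_Act[OF pO q] tp_var[OF GA]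
          Ty_Comp[OF pO p GA(2), symmetric]
          Ty_Comp[OF liftO_Hom[OF p] projO_Hom[OF GA(1)] GA(2), symmetric] projO_liftO[OF p])
    show "\<exists>!u. u \<in> Hom (cat M) \<Delta> (total M O' (free_ext M O' X B)) \<and>
        liftO M O' (proj M \<Gamma> A) \<odot>\<^bsub>M\<^esub> u = \<sigma> \<and> Act (Tm M) u (free_var M O' X B) = a"
      if "\<sigma> \<in> Hom (cat M) \<Delta> (total M O' X)" "a \<in> Sec (Tm M) \<Delta>" "tp M \<Delta> a = Act (Ty M) \<sigma> B" for \<Delta> \<sigma> a
      using extO_ext_universal[OF GA, of \<sigma> \<Delta> a] that unfolding weakened(5,7)
      by (simp add: weakened(1,4) total_Nil)
  qed
next
  case (normal \<Gamma> As)
  note T = total_Obj[OF free_raw[OF X]]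
  have t: "total M O' (\<Gamma>, As @ [B]) = ext M (total M O' X) B"
    by (simp add: total_snoc normal(1))
  show thesis
  proof (rule that)
    show "free_proj M O' X B = (free_ext M O' X B, proj M (total M O' X) B, X)"
      using normal by simp
    show "is_free_arr (free_ext M O' X B) (proj M (total M O' X) B) X"
      using X gen_snoc[OF free_raw[OF normal(2)]]
      by (simp add: is_free_arr_def normal(2,3) t proj_Hom[OF T B]) (simp add: normal(1))
    show "free_var M O' X B \<in> Sec (Tm M) (total M O' (free_ext M O' X B))"
      by (simp add: normal(3,5) t var_Sec[OF T B])
    show "tp M (total M O' (free_ext M O' X B)) (free_var M O' X B) =
        Act (Ty M) (proj M (total M O' X) B) B"
      by (simp add: normal(3,5) t tp_var[OF T B])
    show "\<exists>!u. u \<in> Hom (cat M) \<Delta> (total M O' (free_ext M O' X B)) \<and>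
        proj M (total M O' X) B \<odot>\<^bsub>M\<^esub> u = \<sigma> \<and> Act (Tm M) u (free_var M O' X B) = a"
      if "\<sigma> \<in> Hom (cat M) \<Delta> (total M O' X)" "a \<in> Sec (Tm M) \<Delta>" "tp M \<Delta> a = Act (Ty M) \<sigma> B" for \<Delta> \<sigma> a
      using ext_universal[OF T B that] by (simp add: normal(3,5) t)
  qed
qed

lemma natural_model_free_model: "natural_model (free_model M O')"
proof (rule natural_model.intro)
  show "is_terminal (cat (free_model M O')) (one (free_model M O'))"
    using is_terminal_free_cat by simp
next
  fix X B
  assume "X \<in> Obj (cat (free_model M O'))" "B \<in> Sec (Ty (free_model M O')) X"
  then have X: "X \<in> free_Obj M O'" and B: "B \<in> Sec (Ty M) (total M O' X)" by auto
  obtain p where p: "free_proj M O' X B = (free_ext M O' X B, p, X)"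
      "is_free_arr (free_ext M O' X B) p X"
    and q: "free_var M O' X B \<in> Sec (Tm M) (total M O' (free_ext M O' X B))"
      "tp M (total M O' (free_ext M O' X B)) (free_var M O' X B) = Act (Ty M) p B"
    and universal: "\<And>\<Delta> \<sigma> a. \<lbrakk>\<sigma> \<in> Hom (cat M) \<Delta> (total M O' X); a \<in> Sec (Tm M) \<Delta>;
        tp M \<Delta> a = Act (Ty M) \<sigma> B\<rbrakk> \<Longrightarrow>
      \<exists>!u. u \<in> Hom (cat M) \<Delta> (total M O' (free_ext M O' X B)) \<and> p \<odot>\<^bsub>M\<^esub> u = \<sigma> \<and>
        Act (Tm M) u (free_var M O' X B) = a"
    using X B by (rule free_comprehension) blast
  show "ext (free_model M O') X B \<in> Obj (cat (free_model M O'))"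
    using p by (simp add: is_free_arr_def)
  show "proj (free_model M O') X B \<in> Hom (cat (free_model M O')) (ext (free_model M O') X B) X"
    using p by (simp add: Hom_free_cat)
  show "var (free_model M O') X B \<in> Sec (Tm (free_model M O')) (ext (free_model M O') X B)"
    using q by simp
  have "\<exists>!u. u \<in> Hom (free_cat M O') Y (free_ext M O' X B) \<and>
      Comp (free_cat M O') (free_ext M O' X B, p, X) u = \<phi> \<and>
      Act (Tm (free_model M O')) u (free_var M O' X B) = a"
    if phi: "\<phi> \<in> Hom (free_cat M O') Y X" and a: "a \<in> Sec (Tm M) (total M O' Y)"
      "tp M (total M O' Y) a = Act (Ty (free_model M O')) \<phi> B" for \<phi> Y a
  proof -
    obtain f where phiE: "\<phi> = (Y, f, X)" and f: "is_free_arr Y f X"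
      using phi by (auto simp: Hom_free_cat)
    have "tp M (total M O' Y) a = Act (Ty M) f B"
      using a(2) by (simp add: phiE)
    note ex = universal[OF is_free_arr_Hom[OF f] a(1) this]
    from ex obtain u where u: "u \<in> Hom (cat M) (total M O' Y) (total M O' (free_ext M O' X B))"
        "p \<odot>\<^bsub>M\<^esub> u = f" "Act (Tm M) u (free_var M O' X B) = a"
      by (elim ex1E conjE)
    have uniq: "v = u" if "v \<in> Hom (cat M) (total M O' Y) (total M O' (free_ext M O' X B))"
        "p \<odot>\<^bsub>M\<^esub> v = f" "Act (Tm M) v (free_var M O' X B) = a" for v
      using the1_equality[OF ex, of v] the1_equality[OF ex, of u] that u by simp
    \<comment> \<open>The mediating map u is an arrow of the free category: \<open>gen\<close> of
      the extension is \<open>gen X\<close> restricted along p, and restricting further along u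
      amounts to restricting along f.\<close>
    have "Act (Tm M) u (gen (free_ext M O' X B)) = Act (Tm M) u (Act (Tm M) p (gen X))"
      using p(2) by (simp add: is_free_arr_def)
    also have "\<dots> = gen Y"
      using f by (simp add: Tm_Comp[OF u(1) is_free_arr_Hom[OF p(2)] gen_Sec[OF free_raw[OF X]], symmetric]
          u(2) is_free_arr_def)
    finally have "is_free_arr Y u (free_ext M O' X B)"
      using f p(2) u(1) by (simp add: is_free_arr_def)
    note u_Hom = Hom_free_catI[OF this]
    show ?thesis
    proof (rule ex1I)
      show "(Y, u, free_ext M O' X B) \<in> Hom (free_cat M O') Y (free_ext M O' X B) \<and>
          Comp (free_cat M O') (free_ext M O' X B, p, X) (Y, u, free_ext M O' X B) = \<phi> \<and>
          Act (Tm (free_model M O')) (Y, u, free_ext M O' X B) (free_var M O' X B) = a"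
        using u_Hom u(2,3) by (simp add: phiE)
      fix \<psi>
      assume psi: "\<psi> \<in> Hom (free_cat M O') Y (free_ext M O' X B) \<and>
          Comp (free_cat M O') (free_ext M O' X B, p, X) \<psi> = \<phi> \<and>
          Act (Tm (free_model M O')) \<psi> (free_var M O' X B) = a"
      then obtain v where psiE: "\<psi> = (Y, v, free_ext M O' X B)" and v: "is_free_arr Y v (free_ext M O' X B)"
        unfolding Hom_free_cat by blast
      have "v = u"
        using uniq[OF is_free_arr_Hom[OF v]] psi by (simp add: psiE phiE)
      then show "\<psi> = (Y, u, free_ext M O' X B)" by (simp add: psiE)
    qed
  qed
  then show "is_pullback (cat (free_model M O'))
      (yoneda (cat (free_model M O')) (ext (free_model M O') X B)) (Tm (free_model M O'))
      (yoneda (cat (free_model M O')) X) (Ty (free_model M O'))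
      (element_map (Tm (free_model M O')) (var (free_model M O') X B))
      (yoneda_map (cat (free_model M O')) (proj (free_model M O') X B))
      (tp (free_model M O')) (element_map (Ty (free_model M O')) B)"
    unfolding free_model_simps p(1)
    by (intro small_category.is_pullback_comprehension[OF small_category_free_cat]
        is_presheaf_free_Ty is_presheaf_free_Tm is_natural_free_tp[unfolded free_model_simps] Hom_free_catI[OF p(2)])
      (use q B in simp_all)
qed (use small_category_free_cat is_presheaf_free_Ty is_presheaf_free_Tm is_natural_free_tp in simp_all)

section \<open>The unit \<langle>id, x\<rangle> : X \<rightarrow> I (total X)\<close>

definition diag :: "'o \<times> 'u list \<Rightarrow> 'm"
  where "diag X = pairO (total M O' X) (Id (cat M) (total M O' X)) (gen X)"

lemma
  assumes "X \<in> raw_Obj"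
  shows diag_Hom: "diag X \<in> Hom (cat M) (total M O' X) (extO M O' (total M O' X))"
    and projO_diag: "projO M O' (total M O' X) \<odot>\<^bsub>M\<^esub> diag X = Id (cat M) (total M O' X)"
    and varO_diag: "Act (Tm M) (diag X) (varO (total M O' X)) = gen X"
proof -
  note P = Id_Hom[OF total_Obj[OF assms]] gen_Tm_of[OF assms]
  show "diag X \<in> Hom (cat M) (total M O' X) (extO M O' (total M O' X))"
    and "projO M O' (total M O' X) \<odot>\<^bsub>M\<^esub> diag X = Id (cat M) (total M O' X)"
    and "Act (Tm M) (diag X) (varO (total M O' X)) = gen X"
    unfolding diag_def by (rule pairO_Hom[OF P] projO_pairO[OF P] varO_pairO[OF P])+
qed

lemma is_free_arr_diag:
  assumes "X \<in> free_Obj M O'"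
  shows "is_free_arr X (diag X) (total M O' X, [])"
  using assms free_raw[OF assms]
  by (simp add: is_free_arr_def Nil_free_Obj total_Obj total_Nil diag_Hom gen_Nil varO_diag)

lemma Ty_projO_diag:
  "X \<in> raw_Obj \<Longrightarrow> A \<in> Sec (Ty M) (total M O' X) \<Longrightarrow>
    Act (Ty M) (diag X) (Act (Ty M) (projO M O' (total M O' X)) A) = A"
  by (simp add: Ty_Comp[OF diag_Hom projO_Hom, symmetric] total_Obj projO_diag Ty_Id)

lemma Tm_projO_diag:
  "X \<in> raw_Obj \<Longrightarrow> a \<in> Sec (Tm M) (total M O' X) \<Longrightarrow>
    Act (Tm M) (diag X) (Act (Tm M) (projO M O' (total M O' X)) a) = a"
  by (simp add: Tm_Comp[OF diag_Hom projO_Hom, symmetric] total_Obj projO_diag Tm_Id)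

text \<open>Both sides have f as component in the total of Y; on the \<open>O\<close>-component,
  agreement is exactly that f preserves \<open>gen\<close>.\<close>

lemma diag_natural:
  assumes f: "is_free_arr X f Y"
  shows "liftO M O' f \<odot>\<^bsub>M\<^esub> diag X = diag Y \<odot>\<^bsub>M\<^esub> f"
proof -
  have X: "X \<in> raw_Obj" and Y: "Y \<in> raw_Obj" using f by (auto simp: is_free_arr_def free_raw)
  note fH = is_free_arr_Hom[OF f] and T = total_Obj[OF Y]
  note l = liftO_Hom[OF fH] and p = projO_Hom[OF T]
  show ?thesis
  proof (rule extO_eqI[OF T Comp_Hom[OF diag_Hom[OF X] l] Comp_Hom[OF fH diag_Hom[OF Y]]])
    show "projO M O' (total M O' Y) \<odot>\<^bsub>M\<^esub> (liftO M O' f \<odot>\<^bsub>M\<^esub> diag X) =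
        projO M O' (total M O' Y) \<odot>\<^bsub>M\<^esub> (diag Y \<odot>\<^bsub>M\<^esub> f)"
      unfolding Comp_assoc[OF diag_Hom[OF X] l p] projO_liftO[OF fH]
        Comp_assoc[OF diag_Hom[OF X] projO_Hom[OF total_Obj[OF X]] fH, symmetric] projO_diag[OF X]
        Comp_assoc[OF fH diag_Hom[OF Y] p] projO_diag[OF Y] Comp_Id_left[OF fH] Comp_Id_right[OF fH] ..
    show "Act (Tm M) (liftO M O' f \<odot>\<^bsub>M\<^esub> diag X) (varO (total M O' Y)) =
        Act (Tm M) (diag Y \<odot>\<^bsub>M\<^esub> f) (varO (total M O' Y))"
      using f by (simp add: Tm_Comp[OF diag_Hom[OF X] l varO_Sec[OF T]] varO_liftO[OF fH] varO_diag X Y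
          Tm_Comp[OF fH diag_Hom[OF Y] varO_Sec[OF T]] is_free_arr_def)
  qed
qed

text \<open>The triangle identity at the image of \<Gamma>: the unit followed by the inclusion of
  the counit \<open>p\<^sub>O\<close>. It later pins down the image of the unit over
  (\<Gamma>).\<close>

lemma liftO_projO_diag:
  assumes G: "\<Gamma> \<in> Obj (cat M)"
  shows "liftO M O' (projO M O' \<Gamma>) \<odot>\<^bsub>M\<^esub> diag (\<Gamma>, []) = Id (cat M) (extO M O' \<Gamma>)"
proof -
  have raw: "(\<Gamma>, []) \<in> raw_Obj" using G by (simp add: raw_Obj_def)
  note d = diag_Hom[OF raw, unfolded total_Nil] and p = projO_Hom[OF G] and E = extO_Obj[OF G]
  note l = liftO_Hom[OF p]
  show ?thesis
  proof (rule extO_eqI[OF G Comp_Hom[OF d l] Id_Hom[OF E]])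
    show "projO M O' \<Gamma> \<odot>\<^bsub>M\<^esub> (liftO M O' (projO M O' \<Gamma>) \<odot>\<^bsub>M\<^esub> diag (\<Gamma>, [])) =
        projO M O' \<Gamma> \<odot>\<^bsub>M\<^esub> Id (cat M) (extO M O' \<Gamma>)"
      unfolding Comp_assoc[OF d l p] projO_liftO[OF p] Comp_assoc[OF d projO_Hom[OF E] p, symmetric]
        projO_diag[OF raw, unfolded total_Nil] ..
    show "Act (Tm M) (liftO M O' (projO M O' \<Gamma>) \<odot>\<^bsub>M\<^esub> diag (\<Gamma>, [])) (varO \<Gamma>) =
        Act (Tm M) (Id (cat M) (extO M O' \<Gamma>)) (varO \<Gamma>)"
      using varO_diag[OF raw]
      by (simp add: Tm_Comp[OF d l varO_Sec[OF G]] varO_liftO[OF p] total_Nil gen_Nil G Tm_Id E varO_Sec)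
  qed
qed

end

section \<open>Extending a morphism to the adjoined term\<close>

context nat_model_morphism
begin

lemma obj_Obj: "X \<in> Obj (cat M) \<Longrightarrow> on_obj F X \<in> Obj (cat N)"
  using is_functor unfolding is_functor_def by blast

lemma arr_Hom: "f \<in> Hom (cat M) X Y \<Longrightarrow> on_arr F f \<in> Hom (cat N) (on_obj F X) (on_obj F Y)"
  using is_functor dom.Hom_Obj[of f X Y] unfolding is_functor_def by blast

lemma arr_Id: "X \<in> Obj (cat M) \<Longrightarrow> on_arr F (Id (cat M) X) = Id (cat N) (on_obj F X)"
  using is_functor unfolding is_functor_def by blast

lemma arr_Comp: "f \<in> Hom (cat M) X Y \<Longrightarrow> g \<in> Hom (cat M) Y Z \<Longrightarrow>
    on_arr F (g \<odot>\<^bsub>M\<^esub> f) = on_arr F g \<odot>\<^bsub>N\<^esub> on_arr F f"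
  using is_functor dom.Hom_Obj[of f X Y] dom.Hom_Obj[of g Y Z] unfolding is_functor_def by blast

lemma ty_Sec: "X \<in> Obj (cat M) \<Longrightarrow> A \<in> Sec (Ty M) X \<Longrightarrow> on_ty F X A \<in> Sec (Ty N) (on_obj F X)"
  using on_ty_natural unfolding is_natural_def precomp_def by auto

lemma ty_Act: "f \<in> Hom (cat M) X Y \<Longrightarrow> A \<in> Sec (Ty M) Y \<Longrightarrow>
    on_ty F X (Act (Ty M) f A) = Act (Ty N) (on_arr F f) (on_ty F Y A)"
  using on_ty_natural dom.Hom_Obj[of f X Y] unfolding is_natural_def precomp_def by auto

lemma tm_Sec: "X \<in> Obj (cat M) \<Longrightarrow> a \<in> Sec (Tm M) X \<Longrightarrow> on_tm F X a \<in> Sec (Tm N) (on_obj F X)"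
  using on_tm_natural unfolding is_natural_def precomp_def by auto

lemma tm_Act: "f \<in> Hom (cat M) X Y \<Longrightarrow> a \<in> Sec (Tm M) Y \<Longrightarrow>
    on_tm F X (Act (Tm M) f a) = Act (Tm N) (on_arr F f) (on_tm F Y a)"
  using on_tm_natural dom.Hom_Obj[of f X Y] unfolding is_natural_def precomp_def by auto

lemma arr_to_one: "X \<in> Obj (cat M) \<Longrightarrow> on_arr F (to_one M X) = to_one N (on_obj F X)"
  using arr_Hom[OF dom.to_one_Hom] pres_one cod.to_one_unique by simp

end

locale term_extension_target = nat_model_morphism M N F + term_extension M O'
  for M :: "('o1, 'm1, 'u1, 't1) nat_model" and N :: "('o2, 'm2, 'u2, 't2) nat_model"
    and F O' +
  fixes tm :: 't2
  assumes tm: "tm \<in> Tm_of N (one N) (on_ty F (one M) O')"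
begin

sublocale N: term_extension N "on_ty F (one M) O'"
  by unfold_locales (metis O'_Sec dom.one_Obj pres_one ty_Sec)

abbreviation (input) "FO \<equiv> on_ty F (one M) O'"

section \<open>The image under \<open>F\<close> of extension by \<open>O\<close>\<close>

lemma F_wk: "\<Gamma> \<in> Obj (cat M) \<Longrightarrow> on_ty F \<Gamma> (wk M O' \<Gamma>) = wk N FO (on_obj F \<Gamma>)"
  by (simp add: wk_def ty_Act[OF dom.to_one_Hom O'_Sec] arr_to_one)

lemma F_extO: "\<Gamma> \<in> Obj (cat M) \<Longrightarrow> on_obj F (extO M O' \<Gamma>) = extO N FO (on_obj F \<Gamma>)"
  by (simp add: extO_def pres_ext wk_Sec F_wk)

lemma F_projO: "\<Gamma> \<in> Obj (cat M) \<Longrightarrow> on_arr F (projO M O' \<Gamma>) = projO N FO (on_obj F \<Gamma>)"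
  by (simp add: projO_def pres_proj wk_Sec F_wk)

lemma F_varO: "\<Gamma> \<in> Obj (cat M) \<Longrightarrow> on_tm F (extO M O' \<Gamma>) (varO \<Gamma>) = N.varO (on_obj F \<Gamma>)"
  by (simp add: varO_def extO_def N.varO_def pres_var wk_Sec F_wk)

section \<open>Sections over \<open>tm\<close> and the objects of the extension\<close>

definition tm_at :: "'o2 \<Rightarrow> 't2"
  where "tm_at W = Act (Tm N) (to_one N W) tm"

lemma tm_Sec_one: "tm \<in> Sec (Tm N) (one N)"
  using tm by (simp add: Tm_of_def)

lemma tm_at_Tm_of: "W \<in> Obj (cat N) \<Longrightarrow> tm_at W \<in> Tm_of N W (wk N FO W)"
  unfolding tm_at_def using N.Tm_of_wk_Act[OF cod.to_one_Hom] tm N.wk_one by simp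

lemma tm_at_Act: "g \<in> Hom (cat N) W E \<Longrightarrow> Act (Tm N) g (tm_at E) = tm_at W"
  unfolding tm_at_def
  using cod.Tm_Comp[OF _ cod.to_one_Hom tm_Sec_one] cod.to_one_Comp cod.Hom_Obj_cod by metis

text \<open>Replaces s by s\<cdot>FA for each type in turn. Here s is meant to end at the image of
  \<Theta>, and \<Theta> grows with it so that each A is read in its own context.\<close>

primrec telescope_lift :: "'m2 \<Rightarrow> 'o1 \<Rightarrow> 'u1 list \<Rightarrow> 'm2"
  where
    "telescope_lift s \<Theta> [] = s"
  | "telescope_lift s \<Theta> (A # As) = telescope_lift (lift N s (on_ty F \<Theta> A)) (ext M \<Theta> A) As"

lemma telescope_lift_snoc: "telescope_lift s \<Theta> (As @ [A]) =
    lift N (telescope_lift s \<Theta> As) (on_ty F (ext_list M \<Theta> As) A)"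
  by (induction As arbitrary: s \<Theta>) auto

text \<open>\<open>sect X\<close> will be the image of \<open>\<langle>id, x\<rangle> : X \<rightarrow> I (total X)\<close> under the extension of \<open>F\<close>.
  It exhibits the image of \<open>X\<close> as the fibre over \<open>tm\<close> of \<open>F (total X) \<rightarrow> \<star>\<cdot>FO\<close>.\<close>

definition sect :: "'o1 \<times> 'u1 list \<Rightarrow> 'm2"
  where "sect X = telescope_lift
    (N.pairO (on_obj F (fst X)) (Id (cat N) (on_obj F (fst X))) (tm_at (on_obj F (fst X))))
    (extO M O' (fst X)) (snd X)"

text \<open>Taken as the source of the section: \<open>lift\<close> already starts at the context
  extended by the substituted type, so one recursion yields object and section together.\<close>

definition sharp_obj :: "'o1 \<times> 'u1 list \<Rightarrow> 'o2"
  where "sharp_obj X = Dom (cat N) (sect X)"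

definition sharp_ty :: "'o1 \<times> 'u1 list \<Rightarrow> 'u1 \<Rightarrow> 'u2"
  where "sharp_ty X A = Act (Ty N) (sect X) (on_ty F (total M O' X) A)"

definition sharp_tm :: "'o1 \<times> 'u1 list \<Rightarrow> 't1 \<Rightarrow> 't2"
  where "sharp_tm X a = Act (Tm N) (sect X) (on_tm F (total M O' X) a)"

lemma sect_snoc: "sect (\<Gamma>, As @ [A]) = lift N (sect (\<Gamma>, As)) (on_ty F (total M O' (\<Gamma>, As)) A)"
  by (simp add: sect_def telescope_lift_snoc total_def)

lemma
  assumes "\<Gamma> \<in> Obj (cat M)"
  shows sect_Nil_Hom: "sect (\<Gamma>, []) \<in> Hom (cat N) (on_obj F \<Gamma>) (extO N FO (on_obj F \<Gamma>))"
    and projO_sect_Nil: "projO N FO (on_obj F \<Gamma>) \<odot>\<^bsub>N\<^esub> sect (\<Gamma>, []) = Id (cat N) (on_obj F \<Gamma>)"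
    and varO_sect_Nil: "Act (Tm N) (sect (\<Gamma>, [])) (N.varO (on_obj F \<Gamma>)) = tm_at (on_obj F \<Gamma>)"
proof -
  note G = obj_Obj[OF assms]
  note P = cod.Id_Hom[OF G] tm_at_Tm_of[OF G]
  show "sect (\<Gamma>, []) \<in> Hom (cat N) (on_obj F \<Gamma>) (extO N FO (on_obj F \<Gamma>))"
    and "projO N FO (on_obj F \<Gamma>) \<odot>\<^bsub>N\<^esub> sect (\<Gamma>, []) = Id (cat N) (on_obj F \<Gamma>)"
    and "Act (Tm N) (sect (\<Gamma>, [])) (N.varO (on_obj F \<Gamma>)) = tm_at (on_obj F \<Gamma>)"
    using N.pairO_Hom[OF P] N.projO_pairO[OF P] N.varO_pairO[OF P] by (simp_all add: sect_def)
qed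

lemma sharp_obj_Nil: "\<Gamma> \<in> Obj (cat M) \<Longrightarrow> sharp_obj (\<Gamma>, []) = on_obj F \<Gamma>"
  unfolding sharp_obj_def using Hom_Dom[OF sect_Nil_Hom] .

text \<open>The maps g whose composite with F (total X) \<rightarrow> \<star>\<cdot>FO factors
  through \<langle>id, o\<rangle>, expressed by a term: g restricts the image of \<open>gen\<close>
  to the weakening of o.\<close>

definition over_tm :: "'o1 \<times> 'u1 list \<Rightarrow> 'o2 \<Rightarrow> 'm2 \<Rightarrow> bool"
  where "over_tm X W g \<longleftrightarrow> g \<in> Hom (cat N) W (on_obj F (total M O' X)) \<and>
    Act (Tm N) g (on_tm F (total M O' X) (gen X)) = tm_at W"

lemma sect_universal_Nil:
  assumes G: "\<Gamma> \<in> Obj (cat M)"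
  shows "over_tm (\<Gamma>, []) (sharp_obj (\<Gamma>, [])) (sect (\<Gamma>, []))"
    and "over_tm (\<Gamma>, []) W g \<Longrightarrow>
      \<exists>!h. h \<in> Hom (cat N) W (sharp_obj (\<Gamma>, [])) \<and> sect (\<Gamma>, []) \<odot>\<^bsub>N\<^esub> h = g"
proof -
  note FG = obj_Obj[OF G] and s = sect_Nil_Hom[OF G]
  note pO = N.projO_Hom[OF FG]
  show "over_tm (\<Gamma>, []) (sharp_obj (\<Gamma>, [])) (sect (\<Gamma>, []))"
    using s varO_sect_Nil[OF G]
    by (simp add: over_tm_def sharp_obj_Nil G total_Nil F_extO gen_Nil F_varO)
  assume "over_tm (\<Gamma>, []) W g"
  then have g: "g \<in> Hom (cat N) W (extO N FO (on_obj F \<Gamma>))"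
    and gv: "Act (Tm N) g (N.varO (on_obj F \<Gamma>)) = tm_at W"
    by (simp_all add: over_tm_def G total_Nil F_extO gen_Nil F_varO)
  \<comment> \<open>As the section splits \<open>p\<^sub>O\<close>, the projection of g is the only
    possible factor. It works because the \<open>O\<close>-components of g and of the section are
    both weakenings of \<open>tm\<close>.\<close>
  let ?h = "projO N FO (on_obj F \<Gamma>) \<odot>\<^bsub>N\<^esub> g"
  have h: "?h \<in> Hom (cat N) W (on_obj F \<Gamma>)" by (rule cod.Comp_Hom[OF g pO])
  have "sect (\<Gamma>, []) \<odot>\<^bsub>N\<^esub> ?h = g"
  proof (rule N.extO_eqI[OF FG cod.Comp_Hom[OF h s] g])
    show "projO N FO (on_obj F \<Gamma>) \<odot>\<^bsub>N\<^esub> (sect (\<Gamma>, []) \<odot>\<^bsub>N\<^esub> ?h) = ?h"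
      unfolding cod.Comp_assoc[OF h s pO] projO_sect_Nil[OF G] cod.Comp_Id_left[OF h] ..
    show "Act (Tm N) (sect (\<Gamma>, []) \<odot>\<^bsub>N\<^esub> ?h) (N.varO (on_obj F \<Gamma>)) = Act (Tm N) g (N.varO (on_obj F \<Gamma>))"
      unfolding cod.Tm_Comp[OF h s N.varO_Sec[OF FG]] varO_sect_Nil[OF G] tm_at_Act[OF h] gv ..
  qed
  moreover have "k = ?h" if "k \<in> Hom (cat N) W (on_obj F \<Gamma>)" "sect (\<Gamma>, []) \<odot>\<^bsub>N\<^esub> k = g" for k
    using cod.Comp_assoc[OF that(1) s pO] projO_sect_Nil[OF G] cod.Comp_Id_left[OF that(1)] that(2)
    by simp
  ultimately show "\<exists>!h. h \<in> Hom (cat N) W (sharp_obj (\<Gamma>, [])) \<and> sect (\<Gamma>, []) \<odot>\<^bsub>N\<^esub> h = g"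
    unfolding sharp_obj_Nil[OF G] using h by blast
qed

context
  fixes \<Gamma> As A
  assumes raw: "(\<Gamma>, As @ [A]) \<in> raw_Obj"
    and s_over: "over_tm (\<Gamma>, As) (sharp_obj (\<Gamma>, As)) (sect (\<Gamma>, As))"
begin

private abbreviation (input) "X \<equiv> (\<Gamma>, As)"
private abbreviation (input) "XA \<equiv> (\<Gamma>, As @ [A])"
private abbreviation (input) "FA \<equiv> on_ty F (total M O' X) A"

private lemma X_raw: "X \<in> raw_Obj" and A: "A \<in> Sec (Ty M) (total M O' X)"
  using raw by (simp_all add: raw_snoc)

private lemmas T = total_Obj[OF X_raw]
private lemmas FT = obj_Obj[OF T] and FA = ty_Sec[OF T A]

private lemma s: "sect X \<in> Hom (cat N) (sharp_obj X) (on_obj F (total M O' X))"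
  using s_over by (simp add: over_tm_def)

lemma sharp_obj_snoc: "sharp_obj (\<Gamma>, As @ [A]) = ext N (sharp_obj (\<Gamma>, As)) (sharp_ty (\<Gamma>, As) A)"
  unfolding sharp_obj_def[of XA] sect_snoc Hom_Dom[OF cod.lift_Hom[OF s FA]] sharp_ty_def ..

private lemma s': "sect XA \<in> Hom (cat N) (sharp_obj XA) (ext N (on_obj F (total M O' X)) FA)"
  using cod.lift_Hom[OF s FA] by (simp add: sect_snoc sharp_obj_snoc sharp_ty_def)

private lemma F_total: "on_obj F (total M O' XA) = ext N (on_obj F (total M O' X)) FA"
  by (simp add: total_snoc pres_ext T A)

private lemmas pA = cod.proj_Hom[OF FT FA]
private lemmas F_gen = tm_Sec[OF T gen_Sec[OF X_raw]]

private lemma F_gen_snoc: "on_tm F (total M O' XA) (gen XA) =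
    Act (Tm N) (proj N (on_obj F (total M O' X)) FA) (on_tm F (total M O' X) (gen X))"
  by (simp add: gen_snoc[OF raw] total_snoc tm_Act[OF dom.proj_Hom[OF T A] gen_Sec[OF X_raw]]
      pres_proj T A)

lemma proj_sect_snoc: "on_arr F (proj M (total M O' (\<Gamma>, As)) A) \<odot>\<^bsub>N\<^esub> sect (\<Gamma>, As @ [A]) =
    sect (\<Gamma>, As) \<odot>\<^bsub>N\<^esub> proj N (sharp_obj (\<Gamma>, As)) (sharp_ty (\<Gamma>, As) A)"
  by (simp add: pres_proj T A sect_snoc cod.proj_lift[OF s FA] sharp_ty_def)

lemma var_sect_snoc: "Act (Tm N) (sect (\<Gamma>, As @ [A]))
      (on_tm F (ext M (total M O' (\<Gamma>, As)) A) (var M (total M O' (\<Gamma>, As)) A)) =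
    var N (sharp_obj (\<Gamma>, As)) (sharp_ty (\<Gamma>, As) A)"
  by (simp add: pres_var T A sect_snoc cod.var_lift[OF s FA] sharp_ty_def)

private lemma FAs: "sharp_ty X A \<in> Sec (Ty N) (sharp_obj X)"
  unfolding sharp_ty_def by (rule cod.Ty_Act[OF s FA])

private lemmas S = cod.Hom_Obj_dom[OF s]
private lemmas pS = cod.proj_Hom[OF S FAs]

lemma sect_over_tm_snoc: "over_tm (\<Gamma>, As @ [A]) (sharp_obj (\<Gamma>, As @ [A])) (sect (\<Gamma>, As @ [A]))"
proof -
  have "proj N (on_obj F (total M O' X)) FA \<odot>\<^bsub>N\<^esub> sect XA = sect X \<odot>\<^bsub>N\<^esub> proj N (sharp_obj X) (sharp_ty X A)"
    using proj_sect_snoc by (simp add: pres_proj T A)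
  then have "Act (Tm N) (sect XA) (on_tm F (total M O' XA) (gen XA)) =
      Act (Tm N) (proj N (sharp_obj X) (sharp_ty X A)) (Act (Tm N) (sect X) (on_tm F (total M O' X) (gen X)))"
    by (simp add: F_gen_snoc cod.Tm_Comp[OF s' pA F_gen, symmetric] cod.Tm_Comp[OF pS s F_gen])
  also have "\<dots> = tm_at (sharp_obj XA)"
    using s_over by (simp add: over_tm_def tm_at_Act[OF pS] sharp_obj_snoc)
  finally show ?thesis
    using s' by (simp add: over_tm_def F_total)
qed

text \<open>Pullback pasting: the canonical square of the lifted section sits over the pullback of
  the induction hypothesis. That hypothesis factors the projection of g as k, and the last component
  of g extends k to the mediating map.\<close>

lemma sect_universal_snoc:
  assumes IH: "\<And>W g. over_tm (\<Gamma>, As) W g \<Longrightarrow>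
      \<exists>!h. h \<in> Hom (cat N) W (sharp_obj (\<Gamma>, As)) \<and> sect (\<Gamma>, As) \<odot>\<^bsub>N\<^esub> h = g"
    and g_over: "over_tm (\<Gamma>, As @ [A]) W g"
  shows "\<exists>!h. h \<in> Hom (cat N) W (sharp_obj (\<Gamma>, As @ [A])) \<and> sect (\<Gamma>, As @ [A]) \<odot>\<^bsub>N\<^esub> h = g"
proof -
  let ?E = "on_obj F (total M O' X)"
  let ?p = "proj N ?E FA" and ?q = "var N ?E FA"
  let ?pS = "proj N (sharp_obj X) (sharp_ty X A)" and ?qS = "var N (sharp_obj X) (sharp_ty X A)"
  have g: "g \<in> Hom (cat N) W (ext N ?E FA)"
    and "Act (Tm N) g (on_tm F (total M O' XA) (gen XA)) = tm_at W"
    using g_over by (simp_all add: over_tm_def F_total)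
  then have "over_tm X W (?p \<odot>\<^bsub>N\<^esub> g)"
    by (simp add: over_tm_def cod.Comp_Hom[OF g pA] cod.Tm_Comp[OF g pA F_gen] F_gen_snoc)
  note ex = IH[OF this]
  obtain k where k: "k \<in> Hom (cat N) W (sharp_obj X)" and sk: "sect X \<odot>\<^bsub>N\<^esub> k = ?p \<odot>\<^bsub>N\<^esub> g"
    using ex by (elim ex1E conjE)
  have ps: "?p \<odot>\<^bsub>N\<^esub> sect XA = sect X \<odot>\<^bsub>N\<^esub> ?pS"
    using proj_sect_snoc by (simp add: pres_proj T A)
  have qs: "Act (Tm N) (sect XA) ?q = ?qS"
    using var_sect_snoc by (simp add: pres_var T A)
  note q = cod.var_Sec[OF FT FA]
  have a: "Act (Tm N) g ?q \<in> Sec (Tm N) W" by (rule cod.Tm_Act[OF g q])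
  have ta: "tp N W (Act (Tm N) g ?q) = Act (Ty N) k (sharp_ty X A)"
    unfolding sharp_ty_def cod.Ty_Comp[OF k s FA, symmetric] sk cod.Ty_Comp[OF g pA FA]
      cod.tp_Act[OF g q] cod.tp_var[OF FT FA] ..
  let ?h = "pair N (sharp_obj X) k (sharp_ty X A) (Act (Tm N) g ?q)"
  note h = cod.pair_Hom[OF S FAs k a ta] cod.proj_pair[OF S FAs k a ta] cod.var_pair[OF S FAs k a ta]
  note h' = h(1)[folded sharp_obj_snoc]
  show ?thesis
  proof (rule ex1I)
    have "sect XA \<odot>\<^bsub>N\<^esub> ?h = g"
    proof (rule cod.ext_eqI[OF FT FA cod.Comp_Hom[OF h' s'] g])
      show "?p \<odot>\<^bsub>N\<^esub> (sect XA \<odot>\<^bsub>N\<^esub> ?h) = ?p \<odot>\<^bsub>N\<^esub> g"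
        unfolding cod.Comp_assoc[OF h' s' pA] ps cod.Comp_assoc[OF h(1) pS s, symmetric] h(2) sk ..
      show "Act (Tm N) (sect XA \<odot>\<^bsub>N\<^esub> ?h) ?q = Act (Tm N) g ?q"
        unfolding cod.Tm_Comp[OF h' s' q] qs h(3) ..
    qed
    with h' show "?h \<in> Hom (cat N) W (sharp_obj XA) \<and> sect XA \<odot>\<^bsub>N\<^esub> ?h = g" by blast
    fix w
    assume w_asm: "w \<in> Hom (cat N) W (sharp_obj XA) \<and> sect XA \<odot>\<^bsub>N\<^esub> w = g"
    then have w: "w \<in> Hom (cat N) W (sharp_obj XA)" and sw: "sect XA \<odot>\<^bsub>N\<^esub> w = g" by auto
    note w' = w[unfolded sharp_obj_snoc]
    show "w = ?h"
    proof (rule cod.ext_eqI[OF S FAs w' h(1)])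
      have "sect X \<odot>\<^bsub>N\<^esub> (?pS \<odot>\<^bsub>N\<^esub> w) = ?p \<odot>\<^bsub>N\<^esub> g"
        unfolding cod.Comp_assoc[OF w' pS s] ps[symmetric] cod.Comp_assoc[OF w s' pA, symmetric] sw ..
      then have "?pS \<odot>\<^bsub>N\<^esub> w = k"
        using the1_equality[OF ex, of k] the1_equality[OF ex, of "?pS \<odot>\<^bsub>N\<^esub> w"] k sk
          cod.Comp_Hom[OF w' pS] by simp
      then show "?pS \<odot>\<^bsub>N\<^esub> w = ?pS \<odot>\<^bsub>N\<^esub> ?h"
        by (simp add: h(2))
      have "Act (Tm N) w ?qS = Act (Tm N) g ?q"
        unfolding qs[symmetric] cod.Tm_Comp[OF w s' q, symmetric] sw ..
      then show "Act (Tm N) w ?qS = Act (Tm N) ?h ?qS"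
        by (simp add: h(3))
    qed
  qed
qed

end

text \<open>Both claims go through one induction: the step for the universal property takes
  \<open>over_tm\<close> at the shorter list as a premise, which supplies the typing of the
  section.\<close>

lemma sect_properties:
  assumes "X \<in> raw_Obj"
  shows "over_tm X (sharp_obj X) (sect X) \<and>
    (\<forall>W g. over_tm X W g \<longrightarrow> (\<exists>!h. h \<in> Hom (cat N) W (sharp_obj X) \<and> sect X \<odot>\<^bsub>N\<^esub> h = g))"
proof -
  obtain \<Gamma> As where XE: "X = (\<Gamma>, As)" by fastforce
  have "(\<Gamma>, As) \<in> raw_Obj \<Longrightarrow> over_tm (\<Gamma>, As) (sharp_obj (\<Gamma>, As)) (sect (\<Gamma>, As)) \<and>
    (\<forall>W g. over_tm (\<Gamma>, As) W g \<longrightarrow>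
      (\<exists>!h. h \<in> Hom (cat N) W (sharp_obj (\<Gamma>, As)) \<and> sect (\<Gamma>, As) \<odot>\<^bsub>N\<^esub> h = g))"
  proof (induction As rule: rev_induct)
    case Nil
    then have "\<Gamma> \<in> Obj (cat M)" by (simp add: raw_Obj_def)
    then show ?case using sect_universal_Nil by blast
  next
    case (snoc A As)
    then have "(\<Gamma>, As) \<in> raw_Obj" by (simp add: raw_snoc)
    note IH = snoc.IH[OF this]
    note over = conjunct1[OF IH]
    have universal: "\<exists>!h. h \<in> Hom (cat N) W (sharp_obj (\<Gamma>, As)) \<and> sect (\<Gamma>, As) \<odot>\<^bsub>N\<^esub> h = g"
      if "over_tm (\<Gamma>, As) W g" for W g
      by (rule conjunct2[OF IH, rule_format, OF that])
    show ?case
    proof (intro conjI allI impI)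
      show "over_tm (\<Gamma>, As @ [A]) (sharp_obj (\<Gamma>, As @ [A])) (sect (\<Gamma>, As @ [A]))"
        by (rule sect_over_tm_snoc[OF snoc.prems over])
      fix W g assume g: "over_tm (\<Gamma>, As @ [A]) W g"
      show "\<exists>!h. h \<in> Hom (cat N) W (sharp_obj (\<Gamma>, As @ [A])) \<and> sect (\<Gamma>, As @ [A]) \<odot>\<^bsub>N\<^esub> h = g"
        by (rule sect_universal_snoc[OF snoc.prems over _ g]) (rule universal)
    qed
  qed
  then show ?thesis using assms XE by simp
qed

section \<open>The extension on arrows\<close>

lemma sect_over_tm: "X \<in> raw_Obj \<Longrightarrow> over_tm X (sharp_obj X) (sect X)"
  using sect_properties by blast

lemma sect_universal:
  "X \<in> raw_Obj \<Longrightarrow> over_tm X W g \<Longrightarrow>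
    \<exists>!h. h \<in> Hom (cat N) W (sharp_obj X) \<and> sect X \<odot>\<^bsub>N\<^esub> h = g"
  using sect_properties by blast

lemma sect_Hom: "X \<in> raw_Obj \<Longrightarrow>
    sect X \<in> Hom (cat N) (sharp_obj X) (on_obj F (total M O' X))"
  using sect_over_tm by (simp add: over_tm_def)

text \<open>The composite of \<open>sect X\<close> with k again lies over \<open>tm\<close>,
  weakenings of \<open>tm\<close> being stable under restriction; h and k are then both its unique
  factor.\<close>

lemma sect_mono:
  assumes X: "X \<in> raw_Obj"
    and h: "h \<in> Hom (cat N) W (sharp_obj X)" and k: "k \<in> Hom (cat N) W (sharp_obj X)"
    and eq: "sect X \<odot>\<^bsub>N\<^esub> h = sect X \<odot>\<^bsub>N\<^esub> k"
  shows "h = k"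
proof -
  note s = sect_Hom[OF X]
  have "Act (Tm N) (sect X \<odot>\<^bsub>N\<^esub> k) (on_tm F (total M O' X) (gen X)) = tm_at W"
    using sect_over_tm[OF X] tm_at_Act[OF k]
    by (simp add: cod.Tm_Comp[OF k s tm_Sec[OF total_Obj[OF X] gen_Sec[OF X]]] over_tm_def)
  then have "over_tm X W (sect X \<odot>\<^bsub>N\<^esub> k)"
    using cod.Comp_Hom[OF k s] by (simp add: over_tm_def)
  note ex = sect_universal[OF X this]
  show ?thesis
    by (rule trans[OF sym[OF the1_equality[OF ex conjI[OF h eq]]] the1_equality[OF ex conjI[OF k refl]]])
qed

text \<open>The equation is the image of \<open>diag_natural\<close>, with \<open>sect\<close> in
  place of the units.\<close>

definition sharp_arr :: "('o1, 'm1, 'u1) free_arr \<Rightarrow> 'm2"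
  where "sharp_arr = (\<lambda>(X, f, Y). THE h. h \<in> Hom (cat N) (sharp_obj X) (sharp_obj Y) \<and>
    sect Y \<odot>\<^bsub>N\<^esub> h = on_arr F f \<odot>\<^bsub>N\<^esub> sect X)"

lemma is_free_arr_raw: "is_free_arr X f Y \<Longrightarrow> X \<in> raw_Obj \<and> Y \<in> raw_Obj"
  by (simp add: is_free_arr_def free_raw)

lemma F_arr_sect_Hom:
  assumes "is_free_arr X f Y"
  shows "on_arr F f \<odot>\<^bsub>N\<^esub> sect X \<in> Hom (cat N) (sharp_obj X) (on_obj F (total M O' Y))"
  using cod.Comp_Hom[OF sect_Hom arr_Hom[OF is_free_arr_Hom]] assms is_free_arr_raw by blast

text \<open>F f after the section at X lies over \<open>tm\<close> because f preserves
  \<open>gen\<close>, and thus factors uniquely through the section at Y.\<close>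

lemma
  assumes f: "is_free_arr X f Y"
  shows sharp_arr_Hom: "sharp_arr (X, f, Y) \<in> Hom (cat N) (sharp_obj X) (sharp_obj Y)"
    and sect_sharp_arr: "sect Y \<odot>\<^bsub>N\<^esub> sharp_arr (X, f, Y) = on_arr F f \<odot>\<^bsub>N\<^esub> sect X"
proof -
  have X: "X \<in> raw_Obj" and Y: "Y \<in> raw_Obj" using is_free_arr_raw[OF f] by auto
  note fH = is_free_arr_Hom[OF f]
  have "Act (Tm N) (on_arr F f \<odot>\<^bsub>N\<^esub> sect X) (on_tm F (total M O' Y) (gen Y)) =
      Act (Tm N) (sect X) (on_tm F (total M O' X) (gen X))"
    using f by (simp add: cod.Tm_Comp[OF sect_Hom[OF X] arr_Hom[OF fH] tm_Sec[OF total_Obj[OF Y] gen_Sec[OF Y]]]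
        tm_Act[OF fH gen_Sec[OF Y], symmetric] is_free_arr_def)
  also have "\<dots> = tm_at (sharp_obj X)"
    using sect_over_tm[OF X] by (simp add: over_tm_def)
  finally have "over_tm Y (sharp_obj X) (on_arr F f \<odot>\<^bsub>N\<^esub> sect X)"
    using F_arr_sect_Hom[OF f] by (simp add: over_tm_def)
  from theI'[OF sect_universal[OF Y this]]
  show "sharp_arr (X, f, Y) \<in> Hom (cat N) (sharp_obj X) (sharp_obj Y)"
    and "sect Y \<odot>\<^bsub>N\<^esub> sharp_arr (X, f, Y) = on_arr F f \<odot>\<^bsub>N\<^esub> sect X"
    by (auto simp: sharp_arr_def)
qed

lemma sharp_arr_eqI:
  assumes "is_free_arr X f Y" "h \<in> Hom (cat N) (sharp_obj X) (sharp_obj Y)"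
    "sect Y \<odot>\<^bsub>N\<^esub> h = on_arr F f \<odot>\<^bsub>N\<^esub> sect X"
  shows "sharp_arr (X, f, Y) = h"
  using sect_mono[OF conjunct2[OF is_free_arr_raw] sharp_arr_Hom] sect_sharp_arr assms by metis

lemma sharp_obj_Obj: "X \<in> raw_Obj \<Longrightarrow> sharp_obj X \<in> Obj (cat N)"
  using cod.Hom_Obj_dom[OF sect_Hom] .

lemma sharp_arr_Id:
  assumes X: "X \<in> free_Obj M O'"
  shows "sharp_arr (X, Id (cat M) (total M O' X), X) = Id (cat N) (sharp_obj X)"
proof (rule sharp_arr_eqI[OF is_free_arr_Id[OF X] cod.Id_Hom[OF sharp_obj_Obj[OF free_raw[OF X]]]])
  note s = sect_Hom[OF free_raw[OF X]]
  show "sect X \<odot>\<^bsub>N\<^esub> Id (cat N) (sharp_obj X) = on_arr F (Id (cat M) (total M O' X)) \<odot>\<^bsub>N\<^esub> sect X"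
    by (simp add: arr_Id total_Obj free_raw[OF X] cod.Comp_Id_left[OF s] cod.Comp_Id_right[OF s])
qed

lemma sharp_arr_Comp:
  assumes f: "is_free_arr X f Y" and g: "is_free_arr Y g Z"
  shows "sharp_arr (X, g \<odot>\<^bsub>M\<^esub> f, Z) = sharp_arr (Y, g, Z) \<odot>\<^bsub>N\<^esub> sharp_arr (X, f, Y)"
proof (rule sharp_arr_eqI[OF is_free_arr_Comp[OF f g]])
  note Sf = sharp_arr_Hom[OF f] and Sg = sharp_arr_Hom[OF g]
  note fH = is_free_arr_Hom[OF f] and gH = is_free_arr_Hom[OF g]
  have s: "sect X \<in> Hom (cat N) (sharp_obj X) (on_obj F (total M O' X))"
    "sect Y \<in> Hom (cat N) (sharp_obj Y) (on_obj F (total M O' Y))"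
    "sect Z \<in> Hom (cat N) (sharp_obj Z) (on_obj F (total M O' Z))"
    using is_free_arr_raw[OF f] is_free_arr_raw[OF g] by (auto simp: sect_Hom)
  show "sharp_arr (Y, g, Z) \<odot>\<^bsub>N\<^esub> sharp_arr (X, f, Y) \<in> Hom (cat N) (sharp_obj X) (sharp_obj Z)"
    by (rule cod.Comp_Hom[OF Sf Sg])
  show "sect Z \<odot>\<^bsub>N\<^esub> (sharp_arr (Y, g, Z) \<odot>\<^bsub>N\<^esub> sharp_arr (X, f, Y)) =
      on_arr F (g \<odot>\<^bsub>M\<^esub> f) \<odot>\<^bsub>N\<^esub> sect X"
    unfolding cod.Comp_assoc[OF Sf Sg s(3)] sect_sharp_arr[OF g] cod.Comp_assoc[OF Sf s(2) arr_Hom[OF gH], symmetric]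
      sect_sharp_arr[OF f] cod.Comp_assoc[OF s(1) arr_Hom[OF fH] arr_Hom[OF gH]] arr_Comp[OF fH gH] ..
qed

section \<open>The extension on types and terms\<close>

lemma sharp_ty_Sec: "X \<in> raw_Obj \<Longrightarrow> A \<in> Sec (Ty M) (total M O' X) \<Longrightarrow>
    sharp_ty X A \<in> Sec (Ty N) (sharp_obj X)"
  unfolding sharp_ty_def by (rule cod.Ty_Act[OF sect_Hom ty_Sec[OF total_Obj]])

lemma sharp_tm_Sec: "X \<in> raw_Obj \<Longrightarrow> a \<in> Sec (Tm M) (total M O' X) \<Longrightarrow>
    sharp_tm X a \<in> Sec (Tm N) (sharp_obj X)"
  unfolding sharp_tm_def by (rule cod.Tm_Act[OF sect_Hom tm_Sec[OF total_Obj]])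

lemma sharp_ty_Act:
  assumes f: "is_free_arr X f Y" and A: "A \<in> Sec (Ty M) (total M O' Y)"
  shows "sharp_ty X (Act (Ty M) f A) = Act (Ty N) (sharp_arr (X, f, Y)) (sharp_ty Y A)"
proof -
  have X: "X \<in> raw_Obj" and Y: "Y \<in> raw_Obj" using is_free_arr_raw[OF f] by auto
  note FA = ty_Sec[OF total_Obj[OF Y] A] and fH = is_free_arr_Hom[OF f]
  show ?thesis
    unfolding sharp_ty_def ty_Act[OF fH A] cod.Ty_Comp[OF sect_Hom[OF X] arr_Hom[OF fH] FA, symmetric]
      cod.Ty_Comp[OF sharp_arr_Hom[OF f] sect_Hom[OF Y] FA, symmetric] sect_sharp_arr[OF f] ..
qed

lemma sharp_tm_Act:
  assumes f: "is_free_arr X f Y" and a: "a \<in> Sec (Tm M) (total M O' Y)"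
  shows "sharp_tm X (Act (Tm M) f a) = Act (Tm N) (sharp_arr (X, f, Y)) (sharp_tm Y a)"
proof -
  have X: "X \<in> raw_Obj" and Y: "Y \<in> raw_Obj" using is_free_arr_raw[OF f] by auto
  note Fa = tm_Sec[OF total_Obj[OF Y] a] and fH = is_free_arr_Hom[OF f]
  show ?thesis
    unfolding sharp_tm_def tm_Act[OF fH a] cod.Tm_Comp[OF sect_Hom[OF X] arr_Hom[OF fH] Fa, symmetric]
      cod.Tm_Comp[OF sharp_arr_Hom[OF f] sect_Hom[OF Y] Fa, symmetric] sect_sharp_arr[OF f] ..
qed

lemma tp_sharp_tm:
  assumes X: "X \<in> raw_Obj" and a: "a \<in> Sec (Tm M) (total M O' X)"
  shows "tp N (sharp_obj X) (sharp_tm X a) = sharp_ty X (tp M (total M O' X) a)"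
  unfolding sharp_tm_def sharp_ty_def cod.tp_Act[OF sect_Hom[OF X] tm_Sec[OF total_Obj[OF X] a]]
    pres_tp[OF total_Obj[OF X] a] ..

text \<open>The section at (\<Gamma>) splits \<open>p\<^sub>O\<close>, so restriction along it
  undoes the weakening. In particular types with equal weakenings have equal images under
  \<open>F\<close>, and any choice made by \<open>strengthen\<close> gives the same extension in
  \<open>N\<close>.\<close>

lemma sharp_ty_projO:
  assumes G: "\<Gamma> \<in> Obj (cat M)" and A: "A \<in> Sec (Ty M) \<Gamma>"
  shows "sharp_ty (\<Gamma>, []) (Act (Ty M) (projO M O' \<Gamma>) A) = on_ty F \<Gamma> A"
  by (simp add: sharp_ty_def total_Nil ty_Act[OF projO_Hom[OF G] A] F_projO[OF G]
      cod.Ty_Comp[OF sect_Nil_Hom[OF G] N.projO_Hom[OF obj_Obj[OF G]] ty_Sec[OF G A], symmetric]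
      projO_sect_Nil[OF G] cod.Ty_Id[OF obj_Obj[OF G] ty_Sec[OF G A]])

lemma sharp_tm_projO:
  assumes G: "\<Gamma> \<in> Obj (cat M)" and a: "a \<in> Sec (Tm M) \<Gamma>"
  shows "sharp_tm (\<Gamma>, []) (Act (Tm M) (projO M O' \<Gamma>) a) = on_tm F \<Gamma> a"
  by (simp add: sharp_tm_def total_Nil tm_Act[OF projO_Hom[OF G] a] F_projO[OF G]
      cod.Tm_Comp[OF sect_Nil_Hom[OF G] N.projO_Hom[OF obj_Obj[OF G]] tm_Sec[OF G a], symmetric]
      projO_sect_Nil[OF G] cod.Tm_Id[OF obj_Obj[OF G] tm_Sec[OF G a]])

lemma is_free_arr_liftO:
  "\<sigma> \<in> Hom (cat M) \<Delta> \<Gamma> \<Longrightarrow> is_free_arr (\<Delta>, []) (liftO M O' \<sigma>) (\<Gamma>, [])"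
  by (simp add: is_free_arr_def Nil_free_Obj dom.Hom_Obj_dom dom.Hom_Obj_cod total_Nil liftO_Hom
      gen_Nil varO_liftO)

text \<open>By the characterisation of \<open>sharp_arr\<close> it suffices that F \<sigma> commutes
  with the two sections. Both composites project to F \<sigma> and have a weakening of
  \<open>tm\<close> as \<open>O\<close>-component.\<close>

lemma sharp_arr_liftO:
  assumes s: "\<sigma> \<in> Hom (cat M) \<Delta> \<Gamma>"
  shows "sharp_arr ((\<Delta>, []), liftO M O' \<sigma>, (\<Gamma>, [])) = on_arr F \<sigma>"
proof (rule sharp_arr_eqI[OF is_free_arr_liftO[OF s]])
  note D = dom.Hom_Obj_dom[OF s] and G = dom.Hom_Obj_cod[OF s]
  note FD = obj_Obj[OF D] and FG = obj_Obj[OF G]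
  note sD = sect_Nil_Hom[OF D] and sG = sect_Nil_Hom[OF G] and Fs = arr_Hom[OF s]
  note pD = N.projO_Hom[OF FD] and pG = N.projO_Hom[OF FG]
  have Fl: "on_arr F (liftO M O' \<sigma>) \<in> Hom (cat N) (extO N FO (on_obj F \<Delta>)) (extO N FO (on_obj F \<Gamma>))"
    using arr_Hom[OF liftO_Hom[OF s]] by (simp add: F_extO D G)
  show "on_arr F \<sigma> \<in> Hom (cat N) (sharp_obj (\<Delta>, [])) (sharp_obj (\<Gamma>, []))"
    by (simp add: sharp_obj_Nil D G Fs)
  show "sect (\<Gamma>, []) \<odot>\<^bsub>N\<^esub> on_arr F \<sigma> = on_arr F (liftO M O' \<sigma>) \<odot>\<^bsub>N\<^esub> sect (\<Delta>, [])"
  proof (rule N.extO_eqI[OF FG cod.Comp_Hom[OF Fs sG] cod.Comp_Hom[OF sD Fl]])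
    have pl: "projO N FO (on_obj F \<Gamma>) \<odot>\<^bsub>N\<^esub> on_arr F (liftO M O' \<sigma>) =
        on_arr F \<sigma> \<odot>\<^bsub>N\<^esub> projO N FO (on_obj F \<Delta>)"
      using arr_Comp[OF liftO_Hom[OF s] projO_Hom[OF G]] arr_Comp[OF projO_Hom[OF D] s]
      by (simp add: projO_liftO[OF s] F_projO D G)
    show "projO N FO (on_obj F \<Gamma>) \<odot>\<^bsub>N\<^esub> (sect (\<Gamma>, []) \<odot>\<^bsub>N\<^esub> on_arr F \<sigma>) =
        projO N FO (on_obj F \<Gamma>) \<odot>\<^bsub>N\<^esub> (on_arr F (liftO M O' \<sigma>) \<odot>\<^bsub>N\<^esub> sect (\<Delta>, []))"
      unfolding cod.Comp_assoc[OF Fs sG pG] projO_sect_Nil[OF G] cod.Comp_Id_left[OF Fs]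
        cod.Comp_assoc[OF sD Fl pG] pl cod.Comp_assoc[OF sD pD Fs, symmetric] projO_sect_Nil[OF D]
        cod.Comp_Id_right[OF Fs] ..
    have "Act (Tm N) (on_arr F (liftO M O' \<sigma>)) (N.varO (on_obj F \<Gamma>)) = N.varO (on_obj F \<Delta>)"
      using tm_Act[OF liftO_Hom[OF s] varO_Sec[OF G]] by (simp add: varO_liftO[OF s] F_varO D G)
    then show "Act (Tm N) (sect (\<Gamma>, []) \<odot>\<^bsub>N\<^esub> on_arr F \<sigma>) (N.varO (on_obj F \<Gamma>)) =
        Act (Tm N) (on_arr F (liftO M O' \<sigma>) \<odot>\<^bsub>N\<^esub> sect (\<Delta>, [])) (N.varO (on_obj F \<Gamma>))"
      by (simp add: cod.Tm_Comp[OF Fs sG N.varO_Sec[OF FG]] varO_sect_Nil[OF G] tm_at_Act[OF Fs]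
          cod.Tm_Comp[OF sD Fl N.varO_Sec[OF FG]] varO_sect_Nil[OF D])
  qed
qed

text \<open>The two branches of \<open>free_ext\<close> hold for different reasons. A weakened
  extension is an image under \<open>inclusion\<close>, so preservation by \<open>F\<close> applies;
  in the other branch \<open>sect\<close> was lifted along the new type, which yields the
  equations.\<close>

lemma
  assumes X: "X \<in> free_Obj M O'" and B: "B \<in> Sec (Ty M) (total M O' X)"
  shows sharp_obj_ext: "sharp_obj (free_ext M O' X B) = ext N (sharp_obj X) (sharp_ty X B)"
    and sharp_arr_proj: "sharp_arr (free_proj M O' X B) = proj N (sharp_obj X) (sharp_ty X B)"
    and sharp_tm_var: "sharp_tm (free_ext M O' X B) (free_var M O' X B) = var N (sharp_obj X) (sharp_ty X B)"
proof -
  have "sharp_obj (free_ext M O' X B) = ext N (sharp_obj X) (sharp_ty X B) \<and>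
    sharp_arr (free_proj M O' X B) = proj N (sharp_obj X) (sharp_ty X B) \<and>
    sharp_tm (free_ext M O' X B) (free_var M O' X B) = var N (sharp_obj X) (sharp_ty X B)"
    using X B
  proof (cases rule: free_ext_cases)
    case (weakened \<Gamma> A)
    note GA = weakened(2,3)
    have B': "sharp_ty X B = on_ty F \<Gamma> A"
      by (simp add: weakened(1,4) sharp_ty_projO GA)
    show ?thesis
      unfolding weakened(5-7) B'
      by (simp add: weakened(1) sharp_obj_Nil GA dom.ext_Obj pres_ext pres_proj pres_var
          sharp_arr_liftO[OF dom.proj_Hom[OF GA]] sharp_tm_projO dom.var_Sec)
  next
    case (normal \<Gamma> As)
    note raw = free_raw[OF normal(2)]
    have over: "over_tm (\<Gamma>, As) (sharp_obj (\<Gamma>, As)) (sect (\<Gamma>, As))"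
      using sect_over_tm[OF free_raw[OF X]] normal(1) by simp
    note T = total_Obj[OF free_raw[OF X]]
    have XB: "free_ext M O' X B \<in> free_Obj M O'" using normal(2,3) by simp
    obtain p where p: "free_proj M O' X B = (free_ext M O' X B, p, X)"
      "is_free_arr (free_ext M O' X B) p X"
      using X B by (rule free_comprehension)
    have pE: "p = proj M (total M O' X) B" using p(1) normal(1,3,4) by simp
    have "sharp_arr (free_ext M O' X B, p, X) = proj N (sharp_obj X) (sharp_ty X B)"
    proof (rule sharp_arr_eqI[OF p(2)])
      have "proj N (sharp_obj X) (sharp_ty X B) \<in> Hom (cat N) (ext N (sharp_obj X) (sharp_ty X B)) (sharp_obj X)"
        by (rule cod.proj_Hom[OF sharp_obj_Obj sharp_ty_Sec]) (use X B free_raw in auto)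
      then show "proj N (sharp_obj X) (sharp_ty X B) \<in> Hom (cat N) (sharp_obj (free_ext M O' X B)) (sharp_obj X)"
        using sharp_obj_snoc[OF raw over] unfolding normal(3) by (simp add: normal(1))
      show "sect X \<odot>\<^bsub>N\<^esub> proj N (sharp_obj X) (sharp_ty X B) = on_arr F p \<odot>\<^bsub>N\<^esub> sect (free_ext M O' X B)"
        using proj_sect_snoc[OF raw over] unfolding normal(3) by (simp add: normal(1) pE)
    qed
    then show ?thesis
      using sharp_obj_snoc[OF raw over] var_sect_snoc[OF raw over] unfolding p(1) normal(3,5)
      by (simp add: normal(1) sharp_tm_def total_snoc)
  qed
  then show "sharp_obj (free_ext M O' X B) = ext N (sharp_obj X) (sharp_ty X B)"
    and "sharp_arr (free_proj M O' X B) = proj N (sharp_obj X) (sharp_ty X B)"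
    and "sharp_tm (free_ext M O' X B) (free_var M O' X B) = var N (sharp_obj X) (sharp_ty X B)"
    by auto
qed

section \<open>The extension as a morphism of natural models\<close>

definition sharp where
  "sharp = \<lparr>on_obj = sharp_obj, on_arr = sharp_arr, on_ty = sharp_ty, on_tm = sharp_tm\<rparr>"

lemma sharp_simps [simp]:
  "on_obj sharp = sharp_obj" "on_arr sharp = sharp_arr"
  "on_ty sharp = sharp_ty" "on_tm sharp = sharp_tm"
  by (simp_all add: sharp_def)

lemma nat_model_morphism_sharp: "nat_model_morphism (free_model M O') N sharp"
proof (intro nat_model_morphism.intro natural_model_free_model cod.natural_model_axioms
    nat_model_morphism_axioms.intro)
  show "is_functor (cat (free_model M O')) (cat N) (on_obj sharp) (on_arr sharp)"
    by (auto simp: is_functor_def Hom_free_cat sharp_obj_Obj free_raw sharp_arr_Hom sharp_arr_Id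
        sharp_arr_Comp)
  show "on_obj sharp (one (free_model M O')) = one N"
    by (simp add: sharp_obj_Nil dom.one_Obj pres_one)
  show "is_natural (cat (free_model M O')) (Ty (free_model M O'))
      (precomp (on_obj sharp) (on_arr sharp) (Ty N)) (on_ty sharp)"
    by (auto simp: is_natural_def precomp_def[of sharp_obj] Hom_free_cat sharp_ty_Sec free_raw sharp_ty_Act)
  show "is_natural (cat (free_model M O')) (Tm (free_model M O'))
      (precomp (on_obj sharp) (on_arr sharp) (Tm N)) (on_tm sharp)"
    by (auto simp: is_natural_def precomp_def[of sharp_obj] Hom_free_cat sharp_tm_Sec free_raw sharp_tm_Act)
qed (simp_all add: tp_sharp_tm free_raw sharp_obj_ext sharp_arr_proj sharp_tm_var)

lemma sharp_inclusion: "model_map_eq M (model_map_comp sharp (inclusion M O')) F"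
  by (auto simp: model_map_eq_def model_map_comp_def inclusion_def sharp_obj_Nil sharp_ty_projO
      sharp_tm_projO intro!: sharp_arr_liftO Arr_Hom)

text \<open>x is the variable at (\<diamond>), and the section there is \<langle>id, tm\<rangle>;
  weakening \<open>tm\<close> along the identity of the terminal object changes nothing.\<close>

lemma sharp_free_term: "on_tm sharp (one (free_model M O')) (free_term M O') = tm"
proof -
  have "free_term M O' = varO (one M)"
    by (simp add: free_term_def varO_def wk_one)
  then have "sharp_tm (one M, []) (free_term M O') = tm_at (one N)"
    using varO_sect_Nil[OF dom.one_Obj]
    by (simp add: sharp_tm_def total_Nil F_varO dom.one_Obj pres_one)
  also have "\<dots> = tm"
    by (simp add: tm_at_def cod.to_one_one cod.Tm_Id cod.one_Obj tm_Sec_one)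
  finally show ?thesis by simp
qed

end

section \<open>Uniqueness of the extension\<close>

text \<open>Weakening along \<open>O\<close> need not be injective, so \<open>inclusion M O'\<close> need not preserve context
  extension. The uniqueness proof therefore only uses the values of \<open>G\<close> on its image.\<close>

locale sharp_candidate = term_extension_target M N F O' tm +
  G: nat_model_morphism "free_model M O'" N G
  for M :: "('o1, 'm1, 'u1, 't1) nat_model" and N :: "('o2, 'm2, 'u2, 't2) nat_model"
    and F O' tm G +
  assumes inclusion: "model_map_eq M (model_map_comp G (inclusion M O')) F"
    and free_term: "on_tm G (one (free_model M O')) (free_term M O') = tm"
begin

lemma G_obj: "\<Gamma> \<in> Obj (cat M) \<Longrightarrow> on_obj G (\<Gamma>, []) = on_obj F \<Gamma>"
  using inclusion by (simp add: model_map_eq_def model_map_comp_def inclusion_def)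

lemma G_liftO: "\<sigma> \<in> Hom (cat M) \<Delta> \<Gamma> \<Longrightarrow> on_arr G ((\<Delta>, []), liftO M O' \<sigma>, (\<Gamma>, [])) = on_arr F \<sigma>"
  using inclusion by (auto simp: model_map_eq_def model_map_comp_def inclusion_def Hom_def)

lemma G_ty_projO: "\<Gamma> \<in> Obj (cat M) \<Longrightarrow> A \<in> Sec (Ty M) \<Gamma> \<Longrightarrow>
    on_ty G (\<Gamma>, []) (Act (Ty M) (projO M O' \<Gamma>) A) = on_ty F \<Gamma> A"
  using inclusion by (simp add: model_map_eq_def model_map_comp_def inclusion_def)

lemma G_tm_projO: "\<Gamma> \<in> Obj (cat M) \<Longrightarrow> a \<in> Sec (Tm M) \<Gamma> \<Longrightarrow>
    on_tm G (\<Gamma>, []) (Act (Tm M) (projO M O' \<Gamma>) a) = on_tm F \<Gamma> a"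
  using inclusion by (simp add: model_map_eq_def model_map_comp_def inclusion_def)

lemma G_arr_Hom: "is_free_arr X f Y \<Longrightarrow> on_arr G (X, f, Y) \<in> Hom (cat N) (on_obj G X) (on_obj G Y)"
  using G.arr_Hom by (simp add: Hom_free_catI)

lemma G_arr_Comp: "is_free_arr X f Y \<Longrightarrow> is_free_arr Y g Z \<Longrightarrow>
    on_arr G (X, g \<odot>\<^bsub>M\<^esub> f, Z) = on_arr G (Y, g, Z) \<odot>\<^bsub>N\<^esub> on_arr G (X, f, Y)"
  using G.arr_Comp[of "(X, f, Y)" X Y "(Y, g, Z)" Z] by (simp add: Hom_free_catI)

lemma G_ty_Act: "is_free_arr X f Y \<Longrightarrow> A \<in> Sec (Ty M) (total M O' Y) \<Longrightarrow>
    on_ty G X (Act (Ty M) f A) = Act (Ty N) (on_arr G (X, f, Y)) (on_ty G Y A)"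
  using G.ty_Act[of "(X, f, Y)" X Y] by (simp add: Hom_free_catI)

lemma G_tm_Act: "is_free_arr X f Y \<Longrightarrow> a \<in> Sec (Tm M) (total M O' Y) \<Longrightarrow>
    on_tm G X (Act (Tm M) f a) = Act (Tm N) (on_arr G (X, f, Y)) (on_tm G Y a)"
  using G.tm_Act[of "(X, f, Y)" X Y] by (simp add: Hom_free_catI)

text \<open>The image of the unit under the candidate \<open>G\<close>, to be identified with
  \<open>sect\<close>.\<close>

definition G_diag :: "'o1 \<times> 'u1 list \<Rightarrow> 'm2"
  where "G_diag X = on_arr G (X, diag X, (total M O' X, []))"

lemma G_diag_Hom: "X \<in> free_Obj M O' \<Longrightarrow> G_diag X \<in> Hom (cat N) (on_obj G X) (on_obj F (total M O' X))"
  using G_arr_Hom[OF is_free_arr_diag] by (simp add: G_diag_def G_obj total_Obj free_raw)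

text \<open>A is recovered by restricting its weakening along the unit. Naturality of
  \<open>G\<close> moves the restriction to \<open>N\<close>, and on the weakening, which comes from
  \<open>inclusion\<close>, \<open>G\<close> is \<open>F\<close>.\<close>

lemma G_ty_eq:
  assumes X: "X \<in> free_Obj M O'" and A: "A \<in> Sec (Ty M) (total M O' X)"
  shows "on_ty G X A = Act (Ty N) (G_diag X) (on_ty F (total M O' X) A)"
proof -
  note T = total_Obj[OF free_raw[OF X]]
  have "on_ty G X A = on_ty G X (Act (Ty M) (diag X) (Act (Ty M) (projO M O' (total M O' X)) A))"
    by (simp add: Ty_projO_diag free_raw[OF X] A)
  also have "\<dots> = Act (Ty N) (G_diag X) (on_ty F (total M O' X) A)"
    using G_ty_Act[OF is_free_arr_diag[OF X]] dom.Ty_Act[OF projO_Hom[OF T] A]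
    by (simp add: total_Nil G_diag_def G_ty_projO T A)
  finally show ?thesis .
qed

lemma G_tm_eq:
  assumes X: "X \<in> free_Obj M O'" and a: "a \<in> Sec (Tm M) (total M O' X)"
  shows "on_tm G X a = Act (Tm N) (G_diag X) (on_tm F (total M O' X) a)"
proof -
  note T = total_Obj[OF free_raw[OF X]]
  have "on_tm G X a = on_tm G X (Act (Tm M) (diag X) (Act (Tm M) (projO M O' (total M O' X)) a))"
    by (simp add: Tm_projO_diag free_raw[OF X] a)
  also have "\<dots> = Act (Tm N) (G_diag X) (on_tm F (total M O' X) a)"
    using G_tm_Act[OF is_free_arr_diag[OF X]] dom.Tm_Act[OF projO_Hom[OF T] a]
    by (simp add: total_Nil G_diag_def G_tm_projO T a)
  finally show ?thesis .
qed

lemma G_diag_natural: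
  assumes f: "is_free_arr X f Y"
  shows "on_arr F f \<odot>\<^bsub>N\<^esub> G_diag X = G_diag Y \<odot>\<^bsub>N\<^esub> on_arr G (X, f, Y)"
proof -
  have X: "X \<in> free_Obj M O'" and Y: "Y \<in> free_Obj M O'" using f by (auto simp: is_free_arr_def)
  note fH = is_free_arr_Hom[OF f]
  show ?thesis
    unfolding G_diag_def G_liftO[OF fH, symmetric]
      G_arr_Comp[OF is_free_arr_diag[OF X] is_free_arr_liftO[OF fH], symmetric] diag_natural[OF f]
      G_arr_Comp[OF f is_free_arr_diag[OF Y]] ..
qed

text \<open>Here the value of \<open>G\<close> at x enters: the variable at (\<Gamma>) is x
  restricted along the inclusion of \<open>t\<^sub>\<Gamma>\<close>, and \<open>G\<close> sends that
  arrow to the terminal map of F\<Gamma>.\<close>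

lemma G_varO:
  assumes G: "\<Gamma> \<in> Obj (cat M)"
  shows "on_tm G (\<Gamma>, []) (varO \<Gamma>) = tm_at (on_obj F \<Gamma>)"
proof -
  note t = dom.to_one_Hom[OF G]
  have "on_tm G (one M, []) (varO (one M)) = tm"
    using free_term by (simp add: free_term_def varO_def wk_one)
  then show ?thesis
    using G_tm_Act[OF is_free_arr_liftO[OF t], of "varO (one M)"] varO_Sec[OF dom.one_Obj]
    by (simp add: varO_liftO[OF t] G_liftO[OF t] total_Nil tm_at_def arr_to_one G)
qed

text \<open>The projections agree by the triangle identity, since \<open>G\<close> after
  \<open>inclusion\<close> is \<open>F\<close> on \<open>p\<^sub>O\<close>. The
  \<open>O\<close>-components agree because \<open>G\<close> sends the variable at (\<Gamma>) to the
  weakening of \<open>tm\<close>.\<close>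

lemma G_diag_Nil:
  assumes G: "\<Gamma> \<in> Obj (cat M)"
  shows "G_diag (\<Gamma>, []) = sect (\<Gamma>, [])"
proof -
  note FG = obj_Obj[OF G] and p = projO_Hom[OF G]
  have X: "(\<Gamma>, []) \<in> free_Obj M O'" by (simp add: Nil_free_Obj G)
  have d: "is_free_arr (\<Gamma>, []) (diag (\<Gamma>, [])) (extO M O' \<Gamma>, [])"
    using is_free_arr_diag[OF X] by (simp add: total_Nil)
  have dG: "G_diag (\<Gamma>, []) = on_arr G ((\<Gamma>, []), diag (\<Gamma>, []), (extO M O' \<Gamma>, []))"
    by (simp add: G_diag_def total_Nil)
  have H: "G_diag (\<Gamma>, []) \<in> Hom (cat N) (on_obj F \<Gamma>) (extO N FO (on_obj F \<Gamma>))"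
    using G_diag_Hom[OF X] by (simp add: total_Nil G_obj G F_extO)
  show ?thesis
  proof (rule N.extO_eqI[OF FG H sect_Nil_Hom[OF G]])
    have "projO N FO (on_obj F \<Gamma>) \<odot>\<^bsub>N\<^esub> G_diag (\<Gamma>, []) =
        on_arr G ((\<Gamma>, []), Id (cat M) (extO M O' \<Gamma>), (\<Gamma>, []))"
      unfolding F_projO[OF G, symmetric] G_liftO[OF p, symmetric] dG
        G_arr_Comp[OF d is_free_arr_liftO[OF p], symmetric] liftO_projO_diag[OF G] ..
    also have "\<dots> = Id (cat N) (on_obj F \<Gamma>)"
      using G.arr_Id[of "(\<Gamma>, [])"] by (simp add: X total_Nil G_obj G)
    finally show "projO N FO (on_obj F \<Gamma>) \<odot>\<^bsub>N\<^esub> G_diag (\<Gamma>, []) = projO N FO (on_obj F \<Gamma>) \<odot>\<^bsub>N\<^esub> sect (\<Gamma>, [])"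
      by (simp add: projO_sect_Nil G)
    show "Act (Tm N) (G_diag (\<Gamma>, [])) (N.varO (on_obj F \<Gamma>)) =
        Act (Tm N) (sect (\<Gamma>, [])) (N.varO (on_obj F \<Gamma>))"
      using G_tm_eq[OF X, of "varO \<Gamma>"]
      by (simp add: total_Nil varO_Sec G F_varO G_varO varO_sect_Nil)
  qed
qed

text \<open>\<open>G\<close> preserves the appended projection and variable, so given the shorter
  case both components of \<open>G_diag\<close> in the extended context are forced, and they are
  those of the lifted section.\<close>

lemma G_snoc:
  assumes XB: "(\<Gamma>, As @ [B]) \<in> free_Obj M O'" and X: "(\<Gamma>, As) \<in> free_Obj M O'"
    and obj: "on_obj G (\<Gamma>, As) = sharp_obj (\<Gamma>, As)" and d: "G_diag (\<Gamma>, As) = sect (\<Gamma>, As)"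
  shows "on_obj G (\<Gamma>, As @ [B]) = sharp_obj (\<Gamma>, As @ [B])"
    and "G_diag (\<Gamma>, As @ [B]) = sect (\<Gamma>, As @ [B])"
proof -
  let ?X = "(\<Gamma>, As)" and ?XB = "(\<Gamma>, As @ [B])"
  note raw = free_raw[OF XB]
  note over = sect_over_tm[OF free_raw[OF X]]
  have B: "B \<in> Sec (Ty M) (total M O' ?X)" using raw by (simp add: raw_snoc)
  note T = total_Obj[OF free_raw[OF X]]
  \<comment> \<open>A one-entry list is normal only if its entry is no weakening, so extending by B
    appends instead of collapsing.\<close>
  have not_weakened: "\<not> (As = [] \<and> is_weakened M O' \<Gamma> B)"
    using XB by (auto simp: free_Obj_def)
  have ext: "free_ext M O' ?X B = ?XB"
    and proj: "free_proj M O' ?X B = (?XB, proj M (total M O' ?X) B, ?X)"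
    and var: "free_var M O' ?X B = var M (total M O' ?X) B"
    using not_weakened by (auto simp: free_ext_def free_proj_def free_var_def)
  obtain p where "free_proj M O' ?X B = (free_ext M O' ?X B, p, ?X)"
      "is_free_arr (free_ext M O' ?X B) p ?X"
    using X B by (rule free_comprehension)
  then have p: "is_free_arr ?XB (proj M (total M O' ?X) B) ?X"
    by (simp add: ext proj)
  have ty: "on_ty G ?X B = sharp_ty ?X B"
    by (simp add: G_ty_eq[OF X B] d sharp_ty_def)
  show objB: "on_obj G ?XB = sharp_obj ?XB"
    using G.pres_ext[of ?X B] X B by (simp add: ext obj ty sharp_obj_snoc[OF raw over])
  have G_proj: "on_arr G (?XB, proj M (total M O' ?X) B, ?X) = proj N (sharp_obj ?X) (sharp_ty ?X B)"
    using G.pres_proj[of ?X B] X B by (simp add: proj obj ty)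
  have G_var: "on_tm G ?XB (var M (total M O' ?X) B) = var N (sharp_obj ?X) (sharp_ty ?X B)"
    using G.pres_var[of ?X B] X B by (simp add: ext var obj ty)
  note FT = obj_Obj[OF T] and FB = ty_Sec[OF T B]
  have F_total: "on_obj F (total M O' ?XB) = ext N (on_obj F (total M O' ?X)) (on_ty F (total M O' ?X) B)"
    by (simp add: total_snoc pres_ext T B)
  show "G_diag ?XB = sect ?XB"
  proof (rule cod.ext_eqI[OF FT FB])
    show "G_diag ?XB \<in> Hom (cat N) (sharp_obj ?XB) (ext N (on_obj F (total M O' ?X)) (on_ty F (total M O' ?X) B))"
      using G_diag_Hom[OF XB] by (simp add: objB F_total)
    show "sect ?XB \<in> Hom (cat N) (sharp_obj ?XB) (ext N (on_obj F (total M O' ?X)) (on_ty F (total M O' ?X) B))"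
      using sect_Hom[OF raw] by (simp add: F_total)
    show "proj N (on_obj F (total M O' ?X)) (on_ty F (total M O' ?X) B) \<odot>\<^bsub>N\<^esub> G_diag ?XB =
        proj N (on_obj F (total M O' ?X)) (on_ty F (total M O' ?X) B) \<odot>\<^bsub>N\<^esub> sect ?XB"
      using G_diag_natural[OF p] proj_sect_snoc[OF raw over]
      by (simp add: d G_proj pres_proj T B)
    show "Act (Tm N) (G_diag ?XB) (var N (on_obj F (total M O' ?X)) (on_ty F (total M O' ?X) B)) =
        Act (Tm N) (sect ?XB) (var N (on_obj F (total M O' ?X)) (on_ty F (total M O' ?X) B))"
      using G_tm_eq[OF XB, of "var M (total M O' ?X) B"] var_sect_snoc[OF raw over] dom.var_Sec[OF T B]
      by (simp add: total_snoc G_var pres_var T B)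
  qed
qed

lemma G_eq:
  assumes X: "X \<in> free_Obj M O'"
  shows "on_obj G X = sharp_obj X" and "G_diag X = sect X"
proof -
  have "(\<Gamma>, As) \<in> free_Obj M O' \<Longrightarrow>
      on_obj G (\<Gamma>, As) = sharp_obj (\<Gamma>, As) \<and> G_diag (\<Gamma>, As) = sect (\<Gamma>, As)" for \<Gamma> As
  proof (induction As rule: rev_induct)
    case Nil
    then show ?case by (simp add: Nil_free_Obj G_obj sharp_obj_Nil G_diag_Nil)
  next
    case (snoc B As)
    \<comment> \<open>Dropping the last entry of a longer list leaves its head alone, so prefixes of
      normal forms are normal and the induction stays among them.\<close>
    then have X: "(\<Gamma>, As) \<in> free_Obj M O'"
      by (cases As) (auto simp: free_Obj_def dom.is_telescope_snoc)
    from G_snoc[OF snoc.prems X] snoc.IH[OF X] show ?case by blast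
  qed
  then show "on_obj G X = sharp_obj X" and "G_diag X = sect X"
    using X by (metis surj_pair)+
qed

text \<open>On arrows, naturality at the units is the equation that \<open>sharp_arr\<close> solves
  uniquely; on types and terms the formulas coincide once \<open>G_diag\<close> is
  \<open>sect\<close>.\<close>

lemma model_map_eq_sharp: "model_map_eq (free_model M O') G sharp"
proof -
  have "on_arr G (X, f, Y) = sharp_arr (X, f, Y)" if f: "is_free_arr X f Y" for X f Y
  proof (rule sharp_arr_eqI[OF f, symmetric])
    have X: "X \<in> free_Obj M O'" and Y: "Y \<in> free_Obj M O'" using f by (auto simp: is_free_arr_def)
    show "on_arr G (X, f, Y) \<in> Hom (cat N) (sharp_obj X) (sharp_obj Y)"
      using G_arr_Hom[OF f] by (simp add: G_eq X Y)
    show "sect Y \<odot>\<^bsub>N\<^esub> on_arr G (X, f, Y) = on_arr F f \<odot>\<^bsub>N\<^esub> sect X"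
      using G_diag_natural[OF f] by (simp add: G_eq X Y)
  qed
  then show ?thesis
    by (auto simp: model_map_eq_def Arr_free_cat G_eq G_ty_eq G_tm_eq sharp_ty_def sharp_tm_def)
qed

end

theorem theorem4p2p11:
  fixes C :: "('o1, 'm1, 'u1, 't1) nat_model"
    and D :: "('o2, 'm2, 'u2, 't2) nat_model"
    and O' :: 'u1 and tm :: 't2
    and F :: "('o1, 'm1, 'u1, 't1, 'o2, 'm2, 'u2, 't2) nat_model_map"
  assumes "natural_model C"
    and "O' \<in> Sec (Ty C) (one C)"
    and "natural_model D"
    and "nat_model_morphism C D F"
    and "tm \<in> Tm_of D (one D) (on_ty F (one C) O')"
  shows "\<exists>G. nat_model_morphism (free_model C O') D G \<and>
      model_map_eq C (model_map_comp G (inclusion C O')) F \<and>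
      on_tm G (one (free_model C O')) (free_term C O') = tm \<and>
      (\<forall>G'. nat_model_morphism (free_model C O') D G' \<and>
        model_map_eq C (model_map_comp G' (inclusion C O')) F \<and>
        on_tm G' (one (free_model C O')) (free_term C O') = tm
        \<longrightarrow> model_map_eq (free_model C O') G' G)"
proof -
  interpret term_extension_target C D F O' tm
    using assms by (intro term_extension_target.intro term_extension.intro
        term_extension_axioms.intro term_extension_target_axioms.intro)
  have "model_map_eq (free_model C O') G' sharp"
    if "nat_model_morphism (free_model C O') D G'"
      "model_map_eq C (model_map_comp G' (inclusion C O')) F"
      "on_tm G' (one (free_model C O')) (free_term C O') = tm" for G'
  proof -
    interpret sharp_candidate C D F O' tm G'
      using that term_extension_target_axioms
      by (intro sharp_candidate.intro sharp_candidate_axioms.intro)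
    show ?thesis by (rule model_map_eq_sharp)
  qed
  then show ?thesis
    using nat_model_morphism_sharp sharp_inclusion sharp_free_term by blast
qed

end
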